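(* Let $G=(A\cup B,E)$ be a bipartite graph in which every agent $a\in A$ has a strict partial order over her neighbors. Given a set $F^+\subseteq E$ of forced edges and a set $F^-\subseteq E$ of forbidden edges, one can determine in polynomial time whether there exists a popular assignment $M$ in $G$ such that $F^+\subseteq M$ and $F^-\cap M=\emptyset$.
   Context: Objects (nodes of $B$) have no preferences. For matchings $M,N$, agent $a$ prefers $M$ to $N$ if $a$ is matched in $M$ and either unmatched in $N$ or $M(a)\succ_a N(a)$; $\phi(M,N)$ counts agents preferring $M$ to $N$ and $\Delta(M,N)=\phi(M,N)-\phi(N,M)$. A popular assignment is a perfect matching $M$ with $\Delta(M,N)\ge0$ for every perfect matching $N$ of $G$ (popularity is with respect to all perfect matchings, not only those respecting $F^+$ and $F^-$). *)

theory Defs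
  imports "HOL-Computational_Algebra.Polynomial"
begin

section \<open>Bipartite graphs with one-sided preferences\<close>

text \<open>
  Agents and objects live in two separate types, so the two sides are disjoint and an edge
  \<open>{a, b}\<close> is the pair \<open>(a, b)\<close>. The meaning of \<open>(b, b') \<in> pref G a\<close> is that agent \<open>a\<close>
  strictly prefers \<open>b\<close> to \<open>b'\<close>.
\<close>

record ('a, 'b) pref_graph =
  agents :: "'a set"
  objects :: "'b set"
  edges :: "('a \<times> 'b) set"
  pref :: "'a \<Rightarrow> ('b \<times> 'b) set"

definition neighbors :: "('a, 'b) pref_graph \<Rightarrow> 'a \<Rightarrow> 'b set" where
  "neighbors G a = {b. (a, b) \<in> edges G}"

definition wf_pref_graph :: "('a, 'b) pref_graph \<Rightarrow> bool" where
  "wf_pref_graph G \<longleftrightarrow>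
     finite (agents G) \<and> finite (objects G) \<and> edges G \<subseteq> agents G \<times> objects G \<and>
     (\<forall>a \<in> agents G. pref G a \<subseteq> neighbors G a \<times> neighbors G a \<and>
        irrefl (pref G a) \<and> trans (pref G a))"

definition matching :: "('a, 'b) pref_graph \<Rightarrow> ('a \<times> 'b) set \<Rightarrow> bool" where
  "matching G M \<longleftrightarrow> M \<subseteq> edges G \<and>
     (\<forall>a b a' b'. (a, b) \<in> M \<longrightarrow> (a', b') \<in> M \<longrightarrow> (a = a' \<longleftrightarrow> b = b'))"

definition perfect_matching :: "('a, 'b) pref_graph \<Rightarrow> ('a \<times> 'b) set \<Rightarrow> bool" where
  "perfect_matching G M \<longleftrightarrow>
     matching G M \<and> fst ` M = agents G \<and> snd ` M = objects G"

definition prefers ::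
  "('a, 'b) pref_graph \<Rightarrow> 'a \<Rightarrow> ('a \<times> 'b) set \<Rightarrow> ('a \<times> 'b) set \<Rightarrow> bool" where
  "prefers G a M N \<longleftrightarrow>
     (\<exists>b. (a, b) \<in> M \<and>
        ((\<forall>b'. (a, b') \<notin> N) \<or> (\<exists>b'. (a, b') \<in> N \<and> (b, b') \<in> pref G a)))"

definition phi ::
  "('a, 'b) pref_graph \<Rightarrow> ('a \<times> 'b) set \<Rightarrow> ('a \<times> 'b) set \<Rightarrow> nat" where
  "phi G M N = card {a \<in> agents G. prefers G a M N}"

definition Delta ::
  "('a, 'b) pref_graph \<Rightarrow> ('a \<times> 'b) set \<Rightarrow> ('a \<times> 'b) set \<Rightarrow> int" where
  "Delta G M N = int (phi G M N) - int (phi G N M)"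

definition popular_assignment :: "('a, 'b) pref_graph \<Rightarrow> ('a \<times> 'b) set \<Rightarrow> bool" where
  "popular_assignment G M \<longleftrightarrow>
     perfect_matching G M \<and> (\<forall>N. perfect_matching G N \<longrightarrow> Delta G M N \<ge> 0)"


section \<open>Polynomial time\<close>

text \<open>
  The machine model is a deterministic random-access machine, programmed with structured control
  flow. The memory consists of unboundedly many arrays of natural numbers. The name of an array
  is a constant in the program text, whereas the index into the array is computed, so that one
  program uses a fixed finite number of arrays. A scalar variable is an array of which only cell
  \<open>0\<close> is used.

  The only arithmetic operations are addition and truncated subtraction. One unit of time is
  charged for every node of an evaluated expression and for every executed store, skip and test.
  The bit length of the largest number in memory therefore grows at most linearly with the
  running time, and polynomial time on this machine coincides with polynomial time on Turing
  machines. (With unit-cost multiplication this would fail.)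
\<close>

type_synonym store = "nat \<Rightarrow> nat \<Rightarrow> nat"

datatype aexp =
    Const nat
  | Cell nat aexp
  | Add aexp aexp
  | Sub aexp aexp

fun aval :: "aexp \<Rightarrow> store \<Rightarrow> nat" where
  "aval (Const n) s = n"
| "aval (Cell x e) s = s x (aval e s)"
| "aval (Add e1 e2) s = aval e1 s + aval e2 s"
| "aval (Sub e1 e2) s = aval e1 s - aval e2 s"

fun acost :: "aexp \<Rightarrow> nat" where
  "acost (Const n) = 1"
| "acost (Cell x e) = 1 + acost e"
| "acost (Add e1 e2) = 1 + acost e1 + acost e2"
| "acost (Sub e1 e2) = 1 + acost e1 + acost e2"

text \<open>
  \<open>Put x i e\<close> writes the value of \<open>e\<close> to cell \<open>i\<close> of array \<open>x\<close>. Tests compare with \<open>0\<close>.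
\<close>

datatype com =
    Skip
  | Put nat aexp aexp
  | Seq com com
  | If aexp com com
  | While aexp com

text \<open>
  \<open>exec c s t s'\<close>: started in \<open>s\<close>, the program \<open>c\<close> halts in \<open>s'\<close> after exactly \<open>t\<close> units of time.
\<close>

inductive exec :: "com \<Rightarrow> store \<Rightarrow> nat \<Rightarrow> store \<Rightarrow> bool" where
  Skip: "exec Skip s 1 s"
| Put: "exec (Put x i e) s (1 + acost i + acost e)
          (s(x := (s x)(aval i s := aval e s)))"
| Seq: "exec c1 s t1 s' \<Longrightarrow> exec c2 s' t2 s'' \<Longrightarrow> exec (Seq c1 c2) s (t1 + t2) s''"
| If_nonzero: "aval e s \<noteq> 0 \<Longrightarrow> exec c1 s t s' \<Longrightarrow>
          exec (If e c1 c2) s (1 + acost e + t) s'"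
| If_zero: "aval e s = 0 \<Longrightarrow> exec c2 s t s' \<Longrightarrow>
          exec (If e c1 c2) s (1 + acost e + t) s'"
| While_zero: "aval e s = 0 \<Longrightarrow> exec (While e c) s (1 + acost e) s"
| While_nonzero: "aval e s \<noteq> 0 \<Longrightarrow> exec c s t1 s' \<Longrightarrow> exec (While e c) s' t2 s'' \<Longrightarrow>
          exec (While e c) s (1 + acost e + t1 + t2) s''"

inductive_cases exec_SkipE: "exec Skip s t s'"
inductive_cases exec_PutE: "exec (Put x i e) s t s'"
inductive_cases exec_SeqE: "exec (Seq c1 c2) s t s'"
inductive_cases exec_IfE: "exec (If e c1 c2) s t s'"
inductive_cases exec_WhileE: "exec (While e c) s t s'"

lemma exec_deterministic:
  "exec c s t s' \<Longrightarrow> exec c s u s'' \<Longrightarrow> u = t \<and> s'' = s'"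
proof (induction arbitrary: u s'' rule: exec.induct)
  case Skip
  from Skip.prems show ?case
    by (rule exec_SkipE) simp
next
  case Put
  from Put.prems show ?case
    by (rule exec_PutE) simp
next
  case Seq
  from Seq.prems show ?case
    by (rule exec_SeqE) (metis Seq.IH)
next
  case (If_nonzero e s c1 t s' c2)
  from If_nonzero.prems If_nonzero.hyps(1)
  obtain r where "exec c1 s r s''" "u = 1 + acost e + r"
    by (auto elim: exec_IfE)
  with If_nonzero.IH show ?case by metis
next
  case (If_zero e s c2 t s' c1)
  from If_zero.prems If_zero.hyps(1)
  obtain r where "exec c2 s r s''" "u = 1 + acost e + r"
    by (auto elim: exec_IfE)
  with If_zero.IH show ?case by metis
next
  case (While_zero e s c)
  from While_zero.prems While_zero.hyps(1) show ?case
    by (auto elim: exec_WhileE)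
next
  case (While_nonzero e s c t1 s1 t2 s2)
  from While_nonzero.prems While_nonzero.hyps(1)
  obtain r1 r2 r where "exec c s r1 r" "exec (While e c) r r2 s''" "u = 1 + acost e + r1 + r2"
    by (auto elim: exec_WhileE)
  with While_nonzero.IH show ?case by metis
qed

text \<open>
  The input bits are stored in array \<open>0\<close> and their number in cell \<open>0\<close> of array \<open>1\<close>; all other
  cells are initially \<open>0\<close>. The answer is read off from cell \<open>0\<close> of array \<open>0\<close>.
\<close>

definition input_store :: "bool list \<Rightarrow> store" where
  "input_store w = (\<lambda>x i.
     if x = 0 \<and> i < length w then of_bool (w ! i)
     else if x = 1 \<and> i = 0 then length w
     else 0)"

text \<open>
  The running time is measured in the length of the input word. The set \<open>X\<close> consists of the
  admissible inputs; nothing is required on words that do not encode an element of \<open>X\<close>.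
\<close>

definition poly_time_decidable :: "('i \<Rightarrow> bool list) \<Rightarrow> 'i set \<Rightarrow> ('i \<Rightarrow> bool) \<Rightarrow> bool" where
  "poly_time_decidable enc X P \<longleftrightarrow>
     (\<exists>(c :: com) (p :: nat poly). \<forall>x \<in> X. \<exists>t s.
        exec c (input_store (enc x)) t s \<and>
        t \<le> poly p (length (enc x)) \<and>
        s 0 0 = (if P x then 1 else 0))"


section \<open>Encoding of instances\<close>

text \<open>
  As inputs to a machine, agents and objects are numbered from \<open>0\<close>.
\<close>

definition numbered :: "(nat, nat) pref_graph \<Rightarrow> bool" where
  "numbered G \<longleftrightarrow> agents G = {..<card (agents G)} \<and> objects G = {..<card (objects G)}"

definition edge_bits :: "nat \<Rightarrow> nat \<Rightarrow> (nat \<times> nat) set \<Rightarrow> bool list" where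
  "edge_bits n m F = [(a, b) \<in> F. a \<leftarrow> [0..<n], b \<leftarrow> [0..<m]]"

definition pref_bits :: "nat \<Rightarrow> nat \<Rightarrow> (nat \<Rightarrow> (nat \<times> nat) set) \<Rightarrow> bool list" where
  "pref_bits n m R = [(b, b') \<in> R a. a \<leftarrow> [0..<n], b \<leftarrow> [0..<m], b' \<leftarrow> [0..<m]]"

text \<open>
  The numbers of agents and objects are written in unary, and the edges, the forced edges, the
  forbidden edges and the preferences as 0/1 matrices in row-major order.
\<close>

fun encode :: "(nat, nat) pref_graph \<times> (nat \<times> nat) set \<times> (nat \<times> nat) set \<Rightarrow> bool list" where
  "encode (G, Fp, Fm) = (let n = card (agents G); m = card (objects G) in
     replicate n True @ [False] @ replicate m True @ [False] @
     edge_bits n m (edges G) @ edge_bits n m Fp @ edge_bits n m Fm @ pref_bits n m (pref G))"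

end

theory Submission
  imports Defs
begin

text \<open>
  Linear programming duality suggests a certificate of popularity: a perfect matching \<open>M\<close> is
  popular iff there are levels \<open>l\<close> of the objects such that, for each \<open>(a, b) \<in> M\<close> and each neighbor
  \<open>b'\<close> of \<open>a\<close>, \<open>l b' + [a prefers b'] - [a prefers b] \<le> l b\<close>. Summing along a perfect matching \<open>N\<close>
  shows \<open>\<Delta>(M, N) \<ge> 0\<close>; conversely the maximum weight of a simple path is such a level function,
  since popularity excludes cycles of positive weight, and it is at most the number of objects.

  For given levels, call an edge admissible if it satisfies these inequalities, is not forbidden
  and is not in conflict with a forced edge at its agent. Starting from level \<open>0\<close>, repeatedly compute
  a maximum matching of the admissible edges and raise each unmatched object by one. If \<open>l*\<close>
  certifies a solution and \<open>l \<le> l*\<close>, then an object with \<open>l b = l* b\<close> is matched, for otherwise its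
  alternating path with the solution would augment the matching. So \<open>l \<le> l*\<close> is invariant, and the
  levels become stable after a quadratic number of rounds iff a solution exists.

  The maximum matching is found by an auction, in which an unmatched object takes the cheapest
  agent and raises the price of that agent by one, until this price would exceed the number of
  agents plus one. This avoids the search for augmenting paths.
\<close>

section \<open>Loop programs\<close>

text \<open>Every loop has a bound fixed on entry, so each program denotes a total function on
  stores, and correctness can be proved without reasoning about \<open>exec\<close>.\<close>

datatype prog =
    Nop
  | Assign nat aexp aexp
  | Then prog prog
  | Cond aexp prog prog
  | For nat nat prog

definition upd :: "nat \<Rightarrow> nat \<Rightarrow> nat \<Rightarrow> store \<Rightarrow> store" where
  "upd x i v s = s(x := (s x)(i := v))"

lemma upd_apply: "upd x i v s y j = (if y = x \<and> j = i then v else s y j)"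
  by (simp add: upd_def)

lemma upd_other [simp]: "y \<noteq> x \<Longrightarrow> upd x i v s y = s y"
  by (simp add: upd_def)

text \<open>The counter is reset after each round, whatever the body did to it. This agrees with the
  \<open>While\<close> loop of \<open>code\<close> once the body writes neither the counter nor the
  bound.\<close>

fun sem :: "prog \<Rightarrow> store \<Rightarrow> store" where
  "sem Nop s = s"
| "sem (Assign x i e) s = upd x (aval i s) (aval e s) s"
| "sem (Then p q) s = sem q (sem p s)"
| "sem (Cond e p q) s = (if aval e s \<noteq> 0 then sem p s else sem q s)"
| "sem (For i x p) s =
     rec_nat (upd i 0 0 s) (\<lambda>k s'. upd i 0 (Suc k) (sem p s')) (s x 0)"

fun code :: "prog \<Rightarrow> com" where
  "code Nop = Skip"
| "code (Assign x i e) = Put x i e"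
| "code (Then p q) = Seq (code p) (code q)"
| "code (Cond e p q) = If e (code p) (code q)"
| "code (For i x p) = Seq (Put i (Const 0) (Const 0))
     (While (Sub (Cell x (Const 0)) (Cell i (Const 0)))
        (Seq (code p) (Put i (Const 0) (Add (Cell i (Const 0)) (Const 1)))))"

fun writes :: "prog \<Rightarrow> nat set" where
  "writes Nop = {}"
| "writes (Assign x i e) = {x}"
| "writes (Then p q) = writes p \<union> writes q"
| "writes (Cond e p q) = writes p \<union> writes q"
| "writes (For i x p) = insert i (writes p)"

fun bounds :: "prog \<Rightarrow> nat set" where
  "bounds Nop = {}"
| "bounds (Assign x i e) = {}"
| "bounds (Then p q) = bounds p \<union> bounds q"
| "bounds (Cond e p q) = bounds p \<union> bounds q"
| "bounds (For i x p) = insert x (bounds p)"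

fun proper :: "prog \<Rightarrow> bool" where
  "proper Nop \<longleftrightarrow> True"
| "proper (Assign x i e) \<longleftrightarrow> True"
| "proper (Then p q) \<longleftrightarrow> proper p \<and> proper q"
| "proper (Cond e p q) \<longleftrightarrow> proper p \<and> proper q"
| "proper (For i x p) \<longleftrightarrow> i \<notin> writes p \<and> proper p"

text \<open>
  The bound of a loop is the number in a cell that the loop does not write. If all these numbers
  are at most \<open>N\<close>, the running time is bounded by a polynomial in \<open>N\<close> read off from the program.
\<close>

fun time_poly :: "prog \<Rightarrow> nat poly" where
  "time_poly Nop = [:1:]"
| "time_poly (Assign x i e) = [:1 + acost i + acost e:]"
| "time_poly (Then p q) = time_poly p + time_poly q"
| "time_poly (Cond e p q) = [:1 + acost e:] + time_poly p + time_poly q"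
| "time_poly (For i x p) = [:9:] + [:0, 1:] * (time_poly p + [:12:])"

lemma sem_frame: "x \<notin> writes p \<Longrightarrow> sem p s x = s x"
proof (induction p arbitrary: s)
  case (For i y p)
  have "rec_nat (upd i 0 0 s) (\<lambda>k s'. upd i 0 (Suc k) (sem p s')) K x = s x" for K
    using For by (induction K) (auto simp: upd_def)
  then show ?case by simp
qed (auto simp: upd_def)

lemma For_invariant:
  assumes "I 0 (upd i 0 0 s)"
    and "\<And>k s'. k < s x 0 \<Longrightarrow> I k s' \<Longrightarrow> s' i 0 = k \<Longrightarrow> I (Suc k) (upd i 0 (Suc k) (sem p s'))"
  shows "I (s x 0) (sem (For i x p) s)"
proof -
  let ?r = "rec_nat (upd i 0 0 s) (\<lambda>k s'. upd i 0 (Suc k) (sem p s'))"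
  have "K \<le> s x 0 \<Longrightarrow> I K (?r K) \<and> ?r K i 0 = K" for K
    using assms by (induction K) (auto simp: upd_apply)
  then show ?thesis by simp
qed

text \<open>The machine cannot multiply, so two nested loops with the same bound supply
  \<open>K * K\<close> rounds. One index counts the rounds across both loops, hence \<open>I\<close>
  must be insensitive to the counters.\<close>

lemma For_For_invariant:
  assumes "I 0 s" and x: "\<And>k s. I k s \<Longrightarrow> s x 0 = K"
    and i: "\<And>k s v. I k s \<Longrightarrow> I k (upd i 0 v s)" and j: "\<And>k s v. I k s \<Longrightarrow> I k (upd j 0 v s)"
    and step: "\<And>k s. I k s \<Longrightarrow> I (Suc k) (sem p s)"
  shows "I (K * K) (sem (For i x (For j x p)) s)"
proof -
  have inner: "I (k + K) (sem (For j x p) s)" if I: "I k s" for k s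
  proof -
    have "I (k + s x 0) (sem (For j x p) s)"
      by (rule For_invariant[where I = "\<lambda>l. I (k + l)"]) (use I j step in auto)
    then show ?thesis using x[OF I] by simp
  qed
  have "I (s x 0 * K) (sem (For i x (For j x p)) s)"
  proof (rule For_invariant[where I = "\<lambda>l. I (l * K)"])
    show "I (0 * K) (upd i 0 0 s)" using i assms(1) by simp
    show "I (Suc l * K) (upd i 0 (Suc l) (sem (For j x p) s'))" if "I (l * K) s'" for l s'
      using i[OF inner[OF that]] by (simp add: add.commute)
  qed
  then show ?thesis using x[OF assms(1)] by (simp only:)
qed

text \<open>No bound is ever written, so each keeps its initial value and the same \<open>N\<close>
  serves at every nesting depth.\<close>

lemma exec_code:
  assumes "proper p" "bounds p \<inter> writes p = {}" "\<And>x. x \<in> bounds p \<Longrightarrow> s x 0 \<le> N"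
  shows "\<exists>t \<le> poly (time_poly p) N. exec (code p) s t (sem p s)"
  using assms
proof (induction p arbitrary: s)
  case Nop
  show ?case using exec.Skip[of s] by auto
next
  case (Assign x i e)
  show ?case
    by (intro exI[of _ "1 + acost i + acost e"] conjI)
      (simp, simp only: code.simps sem.simps upd_def exec.Put)
next
  case (Then p q)
  from Then.prems obtain t1 where t1: "t1 \<le> poly (time_poly p) N" "exec (code p) s t1 (sem p s)"
    using Then.IH(1)[of s] by auto
  have "sem p s x 0 \<le> N" if "x \<in> bounds q" for x
  proof -
    have "x \<notin> writes p" using that Then.prems(2) by auto
    then show ?thesis using that Then.prems(3)[of x] by (simp add: sem_frame)
  qed
  then obtain t2 where "t2 \<le> poly (time_poly q) N" "exec (code q) (sem p s) t2 (sem q (sem p s))"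
    using Then.prems Then.IH(2)[of "sem p s"] by auto
  with t1 show ?case
    by (intro exI[of _ "t1 + t2"]) (auto intro: exec.Seq)
next
  case (Cond e p q)
  obtain t1 where t1: "t1 \<le> poly (time_poly p) N" "exec (code p) s t1 (sem p s)"
    using Cond by auto blast
  obtain t2 where t2: "t2 \<le> poly (time_poly q) N" "exec (code q) s t2 (sem q s)"
    using Cond by auto blast
  show ?case
  proof (cases "aval e s = 0")
    case True
    then show ?thesis using t2 exec.If_zero[OF True t2(2)]
      by (intro exI[of _ "1 + acost e + t2"]) auto
  next
    case False
    then show ?thesis using t1 exec.If_nonzero[OF False t1(2)]
      by (intro exI[of _ "1 + acost e + t1"]) auto
  qed
next
  case (For i x p)
  let ?r = "rec_nat (upd i 0 0 s) (\<lambda>k s'. upd i 0 (Suc k) (sem p s'))"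
  let ?g = "Sub (Cell x (Const 0)) (Cell i (Const 0))"
  let ?b = "Seq (code p) (Put i (Const 0) (Add (Cell i (Const 0)) (Const 1)))"
  let ?T = "poly (time_poly p) N"
  have ix: "i \<noteq> x" "i \<notin> writes p" "x \<notin> writes p" using For.prems by auto
  have bnd: "?r k y = s y" if "y \<in> bounds (For i x p)" for k y
  proof -
    have "y \<notin> insert i (writes p)" using that For.prems(2) by auto
    then show ?thesis by (induction k) (auto simp: upd_def sem_frame)
  qed
  have ri: "?r k i 0 = k" for k
    by (cases k) (auto simp: upd_apply)
  \<comment> \<open>The increment costs 6 and the test of the guard another 6, which makes the 12
    per round in \<open>time_poly\<close>; the initialisation (3) and the last test (6) make the
    9.\<close>
  have step: "\<exists>t \<le> ?T + 6. exec ?b (?r k) t (?r (Suc k))" for k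
  proof -
    have "?r k y 0 \<le> N" if "y \<in> bounds p" for y
      using bnd[of y k] For.prems(3)[of y] that by simp
    then obtain t where t: "t \<le> ?T" "exec (code p) (?r k) t (sem p (?r k))"
      using For.IH[of "?r k"] For.prems by auto
    have "sem p (?r k) i 0 = k" using ix ri[of k] by (simp add: sem_frame)
    then have "exec (Put i (Const 0) (Add (Cell i (Const 0)) (Const 1))) (sem p (?r k)) 6 (?r (Suc k))"
      using exec.Put[of i "Const 0" "Add (Cell i (Const 0)) (Const 1)" "sem p (?r k)"]
      by (simp add: upd_def eval_nat_numeral)
    from exec.Seq[OF t(2) this] t(1) show ?thesis by (intro exI[of _ "t + 6"]) auto
  qed
  \<comment> \<open>A \<open>While\<close> unfolds at its front, so the induction is on the number
    \<open>d\<close> of rounds still to come.\<close>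
  have loop: "\<exists>t \<le> 6 + d * (?T + 12). exec (While ?g ?b) (?r (s x 0 - d)) t (?r (s x 0))"
    if "d \<le> s x 0" for d
    using that
  proof (induction d)
    case 0
    have "aval ?g (?r (s x 0)) = 0" using bnd[of x "s x 0"] ri by simp
    from exec.While_zero[OF this, of ?b] show ?case by (intro exI[of _ 6]) (simp add: eval_nat_numeral)
  next
    case (Suc d)
    let ?k = "s x 0 - Suc d"
    have k: "Suc ?k = s x 0 - d" using Suc.prems by simp
    have "aval ?g (?r ?k) \<noteq> 0" using bnd[of x ?k] ri[of ?k] Suc.prems by simp
    moreover obtain t1 where "t1 \<le> ?T + 6" "exec ?b (?r ?k) t1 (?r (s x 0 - d))"
      using step[of ?k] k by metis
    moreover obtain t2 where "t2 \<le> 6 + d * (?T + 12)"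
      "exec (While ?g ?b) (?r (s x 0 - d)) t2 (?r (s x 0))"
      using Suc by auto
    ultimately show ?case
      by (intro exI[of _ "1 + acost ?g + t1 + t2"] conjI exec.While_nonzero) auto
  qed
  obtain t where t: "t \<le> 6 + s x 0 * (?T + 12)" "exec (While ?g ?b) (?r 0) t (?r (s x 0))"
    using loop[of "s x 0"] by auto
  have "exec (Put i (Const 0) (Const 0)) s 3 (?r 0)"
    using exec.Put[of i "Const 0" "Const 0" s] by (simp add: upd_def eval_nat_numeral)
  from exec.Seq[OF this t(2)] have "exec (code (For i x p)) s (3 + t) (sem (For i x p) s)"
    by simp
  moreover have "s x 0 * (?T + 12) \<le> N * (?T + 12)"
    using For.prems(3)[of x] by (intro mult_right_mono) auto
  then have "6 + s x 0 * (?T + 12) \<le> 6 + N * (?T + 12)" by simp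
  with t(1) have "t \<le> 6 + N * (?T + 12)" by (rule order_trans)
  then have "3 + t \<le> poly (time_poly (For i x p)) N" by simp
  ultimately show ?case by blast
qed

section \<open>Certificates of popularity\<close>

definition outvotes :: "('a, 'b) pref_graph \<Rightarrow> 'a \<Rightarrow> 'b \<Rightarrow> 'b \<Rightarrow> int" where
  "outvotes G a b b' = of_bool ((b, b') \<in> pref G a) - of_bool ((b', b) \<in> pref G a)"

text \<open>These are the dual constraints for a perfect matching of maximum weight with respect to
  the votes against \<open>M\<close>: the dual of an object is its negated level, that of an agent
  the level of her partner, and the dual objective is 0.\<close>

definition certificate :: "('a, 'b) pref_graph \<Rightarrow> ('a \<times> 'b) set \<Rightarrow> ('b \<Rightarrow> int) \<Rightarrow> bool" where
  "certificate G M l \<longleftrightarrow>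
     (\<forall>(a, b) \<in> M. \<forall>b' \<in> neighbors G a. l b' + outvotes G a b' b \<le> l b)"

lemma outvotes_self: "outvotes G a b b = 0"
  by (simp add: outvotes_def)

lemma outvotes_le_1: "outvotes G a b b' \<le> 1"
  by (simp add: outvotes_def)

text \<open>As a bijection, a perfect matching allows sums over agents to be reindexed as sums over
  objects.\<close>

lemma perfect_matching_fun:
  assumes "perfect_matching G M"
  obtains f where "M = (\<lambda>a. (a, f a)) ` agents G" "bij_betw f (agents G) (objects G)"
proof -
  have M: "(a, b) \<in> M \<Longrightarrow> (a', b') \<in> M \<Longrightarrow> a = a' \<longleftrightarrow> b = b'" for a b a' b'
    using assms unfolding perfect_matching_def matching_def by blast
  have im: "fst ` M = agents G" "snd ` M = objects G"
    using assms unfolding perfect_matching_def by auto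
  define f where "f a = (SOME b. (a, b) \<in> M)" for a
  have f: "(a, f a) \<in> M" if "a \<in> agents G" for a
  proof -
    obtain b where "(a, b) \<in> M" using \<open>a \<in> agents G\<close> im(1) by fastforce
    then show ?thesis unfolding f_def by (rule someI)
  qed
  have eq: "M = (\<lambda>a. (a, f a)) ` agents G"
  proof (intro equalityI subsetI)
    fix x assume x: "x \<in> M"
    then have a: "fst x \<in> agents G" using im(1) by blast
    then have "snd x = f (fst x)" using f[OF a] x M by (metis prod.collapse)
    then have "x = (fst x, f (fst x))" by (simp add: prod_eq_iff)
    then show "x \<in> (\<lambda>a. (a, f a)) ` agents G" using a by (rule image_eqI)
  qed (use f in auto)
  moreover have "inj_on f (agents G)"
    by (intro inj_onI) (use f M in blast)
  moreover have "f ` agents G = objects G"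
    using im(2) by (subst (asm) eq) (simp add: image_image)
  ultimately show ?thesis using that by (auto simp: bij_betw_def)
qed

lemma perfect_matching_image:
  assumes "bij_betw f (agents G) (objects G)" "\<And>a. a \<in> agents G \<Longrightarrow> (a, f a) \<in> edges G"
  shows "perfect_matching G ((\<lambda>a. (a, f a)) ` agents G)"
  using assms unfolding perfect_matching_def matching_def bij_betw_def
  by (auto simp: image_image dest: inj_onD)

text \<open>Both matchings assign every agent, so \<open>prefers\<close> reduces to its comparison
  clause and each agent contributes her vote.\<close>

lemma Delta_eq_sum:
  assumes "wf_pref_graph G"
  shows "Delta G ((\<lambda>a. (a, f a)) ` agents G) ((\<lambda>a. (a, g a)) ` agents G)
    = (\<Sum>a \<in> agents G. outvotes G a (f a) (g a))"
proof -
  have fin: "finite (agents G)" using assms by (simp add: wf_pref_graph_def)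
  have phi: "int (phi G ((\<lambda>a. (a, f a)) ` agents G) ((\<lambda>a. (a, g a)) ` agents G))
    = (\<Sum>a \<in> agents G. of_bool ((f a, g a) \<in> pref G a))" for f g
  proof -
    have "{a \<in> agents G. prefers G a ((\<lambda>a. (a, f a)) ` agents G) ((\<lambda>a. (a, g a)) ` agents G)}
      = {a \<in> agents G. (f a, g a) \<in> pref G a}"
      by (auto simp: prefers_def)
    then show ?thesis using fin by (simp add: phi_def of_bool_def sum.If_cases Int_def)
  qed
  show ?thesis by (simp add: Delta_def phi outvotes_def sum_subtractf)
qed

lemma certificate_popular:
  assumes wf: "wf_pref_graph G" and M: "perfect_matching G M" and l: "certificate G M l"
  shows "popular_assignment G M"
  unfolding popular_assignment_def
proof (intro conjI allI impI)
  fix N assume N: "perfect_matching G N"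
  obtain f where f: "M = (\<lambda>a. (a, f a)) ` agents G" "bij_betw f (agents G) (objects G)"
    using perfect_matching_fun[OF M] .
  obtain g where g: "N = (\<lambda>a. (a, g a)) ` agents G" "bij_betw g (agents G) (objects G)"
    using perfect_matching_fun[OF N] .
  have "l (g a) - l (f a) \<le> outvotes G a (f a) (g a)" if a: "a \<in> agents G" for a
  proof -
    have "(a, f a) \<in> M" using a f by simp
    moreover have "g a \<in> neighbors G a"
      using a g N by (auto simp: neighbors_def perfect_matching_def matching_def)
    ultimately have "l (g a) + outvotes G a (g a) (f a) \<le> l (f a)"
      using l by (auto simp: certificate_def)
    then show ?thesis by (simp add: outvotes_def)
  qed
  then have "(\<Sum>a \<in> agents G. l (g a) - l (f a)) \<le> (\<Sum>a \<in> agents G. outvotes G a (f a) (g a))"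
    by (intro sum_mono)
  \<comment> \<open>Both matchings cover every object exactly once, so the levels cancel.\<close>
  moreover have "(\<Sum>a \<in> agents G. l (f a)) = sum l (objects G)"
    "(\<Sum>a \<in> agents G. l (g a)) = sum l (objects G)"
    using f g by (auto intro: sum.reindex_bij_betw)
  ultimately show "0 \<le> Delta G M N"
    unfolding f(1) g(1) Delta_eq_sum[OF wf] by (simp add: sum_subtractf)
qed (rule M)

section \<open>Potentials of digraphs without positive cycles\<close>

fun path_weight :: "('b \<Rightarrow> 'b \<Rightarrow> int) \<Rightarrow> 'b list \<Rightarrow> int" where
  "path_weight w (x # y # xs) = w x y + path_weight w (y # xs)"
| "path_weight w _ = 0"

lemma path_weight_append:
  "path_weight w (xs @ y # ys) = path_weight w (xs @ [y]) + path_weight w (y # ys)"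
  by (induction xs rule: induct_list012) auto

lemma path_weight_le:
  assumes "\<And>x y. w x y \<le> 1"
  shows "path_weight w (x # xs) \<le> int (length xs)"
proof (induction xs arbitrary: x)
  case (Cons y ys)
  have "w x y \<le> 1" "path_weight w (y # ys) \<le> int (length ys)" using assms Cons by auto
  then show ?case by simp
qed simp

text \<open>
  If the heaviest simple path from \<open>y\<close> already visits \<open>x\<close>, then its initial part and the arc
  from \<open>x\<close> to \<open>y\<close> form a cycle, which can be removed without loss of weight.
\<close>

lemma potential_exists:
  fixes w :: "'b \<Rightarrow> 'b \<Rightarrow> int"
  assumes fin: "finite V" and r: "\<And>x y. r x y \<Longrightarrow> x \<in> V \<and> y \<in> V"
    and le1: "\<And>x y. w x y \<le> 1"
    and cyc: "\<And>x xs. distinct (x # xs) \<Longrightarrow> successively r (x # xs @ [x]) \<Longrightarrow>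
      path_weight w (x # xs @ [x]) \<le> 0"
  obtains l where "\<And>x. x \<in> V \<Longrightarrow> 0 \<le> l x \<and> l x \<le> int (card V)"
    and "\<And>x y. r x y \<Longrightarrow> l y + w x y \<le> l x"
proof -
  \<comment> \<open>\<open>S x\<close> holds the simple paths from \<open>x\<close>, with
    \<open>x\<close> itself left off.\<close>
  define S where "S x = {xs. set (x # xs) \<subseteq> V \<and> distinct (x # xs) \<and> successively r (x # xs)}" for x
  define l where "l x = Max ((\<lambda>xs. path_weight w (x # xs)) ` S x)" for x
  have len: "length xs \<le> card V" if "xs \<in> S x" for x xs
    using that fin card_mono[of V "set xs"] by (auto simp: S_def distinct_card)
  have finS: "finite (S x)" for x
    by (rule finite_subset[OF _ finite_lists_length_le[OF fin, of "card V"]])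
      (use len in \<open>auto simp: S_def\<close>)
  have nil: "[] \<in> S x" if "x \<in> V" for x using that by (simp add: S_def)
  have l_ge: "path_weight w (x # xs) \<le> l x" if "xs \<in> S x" for x xs
    unfolding l_def using that finS by auto
  have l_at: "\<exists>xs \<in> S x. l x = path_weight w (x # xs)" if "x \<in> V" for x
  proof -
    have "l x \<in> (\<lambda>xs. path_weight w (x # xs)) ` S x"
      unfolding l_def using finS nil[OF that] by (intro Max_in) auto
    then show ?thesis by auto
  qed
  show ?thesis
  proof
    fix x assume x: "x \<in> V"
    obtain xs where xs: "xs \<in> S x" "l x = path_weight w (x # xs)" using l_at[OF x] by blast
    \<comment> \<open>Arcs weigh at most 1 and a simple path has at most \<open>card V\<close>
      vertices; the path without arcs gives the lower bound 0.\<close>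
    have "path_weight w (x # xs) \<le> int (length xs)" by (rule path_weight_le) (rule le1)
    then show "0 \<le> l x \<and> l x \<le> int (card V)"
      using xs len[OF xs(1)] l_ge[OF nil[OF x]] by simp
  next
    fix x y assume xy: "r x y"
    then have V: "x \<in> V" "y \<in> V" using r by auto
    obtain xs where xs: "xs \<in> S y" "l y = path_weight w (y # xs)" using l_at[OF V(2)] by blast
    show "l y + w x y \<le> l x"
    proof (cases "x \<in> set (y # xs)")
      case False
      then have "y # xs \<in> S x" using xs(1) V xy by (simp add: S_def)
      from l_ge[OF this] show ?thesis using xs(2) by simp
    next
      case True
      then obtain ys zs where yz: "y # xs = ys @ x # zs" by (metis split_list)
      have yS: "set (ys @ x # zs) \<subseteq> V" "distinct (ys @ x # zs)" "successively r (ys @ x # zs)"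
        using xs(1) unfolding S_def yz[symmetric] by blast+
      have zs: "zs \<in> S x"
        using yS by (auto simp: S_def successively_append_iff)
      have "successively r (x # ys @ [x])"
      proof (cases ys)
        case Nil then show ?thesis using yz xy by simp
      next
        case (Cons y' ys')
        then have "y' = y" using yz by simp
        then show ?thesis
          using yS(3) xy Cons successively_append_iff[of r "y # ys'"] by auto
      qed
      moreover have "distinct (x # ys)" using yS(2) by auto
      ultimately have "path_weight w (x # ys @ [x]) \<le> 0" using cyc by blast
      moreover have "path_weight w (x # ys @ [x]) = w x y + path_weight w (ys @ [x])"
        using yz by (cases ys) auto
      moreover have "l y = path_weight w (ys @ [x]) + path_weight w (x # zs)"
        unfolding xs(2) yz by (rule path_weight_append)
      ultimately show ?thesis using l_ge[OF zs] by simp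
    qed
  qed
qed

lemma path_weight_sum:
  "path_weight w xs = (\<Sum>i < length xs - 1. w (xs ! i) (xs ! Suc i))"
proof (induction xs rule: induct_list012)
  case (3 x y zs)
  then show ?case by (simp add: sum.lessThan_Suc_shift del: sum.lessThan_Suc)
qed auto

text \<open>Passing to the successor permutes the vertices of a cycle, which turns the weight of the
  cycle into a sum over a set. The permutation depends on the cycle alone, so one \<open>p\<close>
  serves all \<open>r\<close> and \<open>w\<close>.\<close>

lemma cycle_permutation:
  assumes "distinct (x # xs)"
  obtains p where "bij_betw p (set (x # xs)) (set (x # xs))"
    and "\<And>r y. successively r (x # xs @ [x]) \<Longrightarrow> y \<in> set (x # xs) \<Longrightarrow> r y (p y)"
    and "\<And>w. path_weight w (x # xs @ [x]) = (\<Sum>y \<in> set (x # xs). w y (p y))"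
proof -
  let ?c = "x # xs" and ?d = "xs @ [x]"
  define p where "p y = ?d ! (THE i. i < length ?c \<and> ?c ! i = y)" for y
  have p: "p (?c ! i) = ?d ! i" if "i < length ?c" for i
  proof -
    have "(THE j. j < length ?c \<and> ?c ! j = ?c ! i) = i"
      using that assms by (intro the_equality) (auto simp: nth_eq_iff_index_eq simp del: distinct.simps)
    then show ?thesis by (simp add: p_def)
  qed
  have bc: "bij_betw ((!) ?c) {..<length ?c} (set ?c)"
    using assms by (intro bij_betw_nth) auto
  have "bij_betw ((!) ?d) {..<length ?c} (set ?c)"
    using assms by (intro bij_betw_nth) auto
  then have "bij_betw (p \<circ> (!) ?c) {..<length ?c} (set ?c)"
    by (rule bij_betw_cong[THEN iffD1, rotated]) (simp only: o_apply p lessThan_iff)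
  then have 1: "bij_betw p (set ?c) (set ?c)"
    using bc bij_betw_comp_iff by blast
  have 2: "r y (p y)" if su: "successively r (x # xs @ [x])" and y: "y \<in> set ?c" for r y
  proof -
    obtain i where i: "i < length ?c" "y = ?c ! i" using y by (metis in_set_conv_nth)
    have "r ((x # ?d) ! i) ((x # ?d) ! Suc i)"
      using su i(1) by (simp add: successively_conv_nth)
    moreover have "(x # ?d) ! i = ?c ! i" using i(1) by (cases i) (auto simp: nth_append)
    ultimately show ?thesis using p[OF i(1)] i(2) by simp
  qed
  have 3: "path_weight w (x # xs @ [x]) = (\<Sum>y \<in> set ?c. w y (p y))" for w
  proof -
    have "path_weight w (x # ?d) = (\<Sum>i < length ?c. w (?c ! i) (?d ! i))"
      unfolding path_weight_sum
    proof (rule sum.cong)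
      fix i assume "i \<in> {..<length ?c}"
      then have "(x # ?d) ! i = ?c ! i" by (cases i) (auto simp: nth_append)
      then show "w ((x # ?d) ! i) ((x # ?d) ! Suc i) = w (?c ! i) (?d ! i)" by simp
    qed simp
    also have "\<dots> = (\<Sum>i < length ?c. w (?c ! i) (p (?c ! i)))"
      by (rule sum.cong) (simp_all only: p lessThan_iff)
    also have "\<dots> = (\<Sum>y \<in> set ?c. w y (p y))"
      using bc by (rule sum.reindex_bij_betw)
    finally show ?thesis .
  qed
  show ?thesis by (rule that) (fact 1, fact 2, fact 3)
qed

text \<open>Draw an arc from \<open>b\<close> to each neighbor of the agent holding
  \<open>b\<close>, weighted by her vote for the change. Moving the agents along a cycle of positive
  weight would give a perfect matching that defeats \<open>M\<close>, so
  \<open>potential_exists\<close> applies.\<close>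

lemma popular_certificate:
  assumes wf: "wf_pref_graph G" and pop: "popular_assignment G M"
  obtains l where "certificate G M l"
    and "\<forall>b \<in> objects G. 0 \<le> l b \<and> l b \<le> int (card (objects G))"
proof -
  have M: "perfect_matching G M" using pop by (simp add: popular_assignment_def)
  obtain f where f: "M = (\<lambda>a. (a, f a)) ` agents G" "bij_betw f (agents G) (objects G)"
    using perfect_matching_fun[OF M] .
  have ME: "M \<subseteq> edges G" using M by (simp add: perfect_matching_def matching_def)
  define h where "h = inv_into (agents G) f"
  have h: "h b \<in> agents G" "f (h b) = b" if "b \<in> objects G" for b
    using f(2) that unfolding h_def bij_betw_def
    by (auto simp: f_inv_into_f inv_into_into)
  have hf: "h (f a) = a" if "a \<in> agents G" for a
    using f(2) that unfolding h_def by (simp add: bij_betw_def)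
  define r where "r b b' \<longleftrightarrow> b \<in> objects G \<and> (h b, b') \<in> edges G" for b b'
  define w where "w b b' = outvotes G (h b) b' b" for b b'
  have fin: "finite (objects G)" using wf by (simp add: wf_pref_graph_def)
  have r: "x \<in> objects G \<and> y \<in> objects G" if "r x y" for x y
    using that wf by (auto simp: r_def wf_pref_graph_def)
  have cyc: "path_weight w (x # xs @ [x]) \<le> 0"
    if dis: "distinct (x # xs)" and su: "successively r (x # xs @ [x])" for x xs
  proof -
    obtain p where p: "bij_betw p (set (x # xs)) (set (x # xs))"
      "\<And>y. y \<in> set (x # xs) \<Longrightarrow> r y (p y)"
      "path_weight w (x # xs @ [x]) = (\<Sum>y \<in> set (x # xs). w y (p y))"
      using cycle_permutation[OF dis] su by metis
    let ?C = "set (x # xs)"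
    have C: "?C \<subseteq> objects G" using p(2) r by blast
    \<comment> \<open>Extended by the identity off the cycle, \<open>p\<close> permutes all objects,
      so composing it with \<open>f\<close> gives a perfect matching again.\<close>
    define p' where "p' b = (if b \<in> ?C then p b else b)" for b
    have "bij_betw p' ?C ?C"
      using p(1) by (rule bij_betw_cong[THEN iffD1, rotated]) (simp add: p'_def)
    moreover have "bij_betw p' (objects G - ?C) (objects G - ?C)"
      using bij_betw_id by (rule bij_betw_cong[THEN iffD1, rotated]) (simp add: p'_def)
    ultimately have "bij_betw p' (?C \<union> (objects G - ?C)) (?C \<union> (objects G - ?C))"
      by (rule bij_betw_combine) auto
    then have bp: "bij_betw p' (objects G) (objects G)" using C by (simp only: Un_Diff_cancel Un_absorb1)
    have "(a, p' (f a)) \<in> edges G" if a: "a \<in> agents G" for a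
    proof (cases "f a \<in> ?C")
      case True
      then show ?thesis using p(2)[OF True] hf[OF a] by (simp add: p'_def r_def)
    next
      case False
      then show ?thesis using ME f(1) a by (auto simp: p'_def)
    qed
    then have "perfect_matching G ((\<lambda>a. (a, (p' \<circ> f) a)) ` agents G)"
      by (intro perfect_matching_image bij_betw_trans[OF f(2) bp]) simp
    then have "0 \<le> Delta G M ((\<lambda>a. (a, (p' \<circ> f) a)) ` agents G)"
      using pop by (simp add: popular_assignment_def)
    also have "\<dots> = (\<Sum>a \<in> agents G. outvotes G a (f a) (p' (f a)))"
      unfolding f(1) Delta_eq_sum[OF wf] by simp
    also have "\<dots> = (\<Sum>a \<in> agents G. - w (f a) (p' (f a)))"
      by (rule sum.cong) (simp_all add: w_def hf outvotes_def)
    also have "\<dots> = (\<Sum>b \<in> objects G. - w b (p' b))"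
      using f(2) by (rule sum.reindex_bij_betw)
    \<comment> \<open>Objects off the cycle are compared with themselves and contribute 0.\<close>
    also have "\<dots> = (\<Sum>b \<in> ?C. - w b (p b))"
      using fin C by (intro sum.mono_neutral_cong_right) (auto simp: p'_def w_def outvotes_self)
    finally show ?thesis unfolding p(3) by (simp add: sum_negf)
  qed
  obtain l where l: "\<And>x. x \<in> objects G \<Longrightarrow> 0 \<le> l x \<and> l x \<le> int (card (objects G))"
    "\<And>x y. r x y \<Longrightarrow> l y + w x y \<le> l x"
  proof (rule potential_exists[of "objects G" r w])
    show "w x y \<le> 1" for x y by (simp add: w_def outvotes_le_1)
  qed (use fin r cyc in blast)+
  have "certificate G M l"
    unfolding certificate_def
  proof (clarify)
    fix a b b' assume ab: "(a, b) \<in> M" and b': "b' \<in> neighbors G a"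
    have a: "a \<in> agents G" "b = f a" using ab f(1) by auto
    then have "r b b'" using b' f(2) hf by (auto simp: r_def neighbors_def bij_betw_def)
    from l(2)[OF this] show "l b' + outvotes G a b' b \<le> l b" using hf a by (simp add: w_def)
  qed
  then show ?thesis using that l(1) by blast
qed

section \<open>Matching by auction\<close>

locale auction =
  fixes n m :: nat and adm :: "nat \<Rightarrow> nat \<Rightarrow> bool"
begin

text \<open>Object \<open>b\<close> is stored as \<open>Suc b\<close>, so that \<open>0\<close> marks a free agent.\<close>

definition state :: "(nat \<Rightarrow> nat) \<Rightarrow> (nat \<Rightarrow> nat) \<Rightarrow> (nat \<Rightarrow> nat) \<Rightarrow> bool" where
  "state q ma mb \<longleftrightarrow>
     (\<forall>a<n. q a \<le> Suc n) \<and> (\<forall>a<n. ma a = 0 \<longrightarrow> q a = 0) \<and>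
     (\<forall>a<n. \<forall>b. ma a = Suc b \<longrightarrow> b < m \<and> adm a b \<and> (\<forall>a'<n. adm a' b \<longrightarrow> q a \<le> Suc (q a'))) \<and>
     (\<forall>a<n. \<forall>a'<n. ma a = ma a' \<longrightarrow> ma a \<noteq> 0 \<longrightarrow> a = a') \<and>
     (\<forall>b<m. mb b \<noteq> 0 \<longleftrightarrow> (\<exists>a<n. ma a = Suc b))"

text \<open>Bids are only made on agents priced at most \<open>n\<close>, so the second alternative
  describes an object that has to give up.\<close>

definition settled :: "(nat \<Rightarrow> nat) \<Rightarrow> (nat \<Rightarrow> nat) \<Rightarrow> nat \<Rightarrow> bool" where
  "settled q mb b \<longleftrightarrow> mb b \<noteq> 0 \<or> (\<forall>a<n. adm a b \<longrightarrow> n < q a)"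

lemma state_initial:
  assumes "\<And>a. a < n \<Longrightarrow> q a = 0" "\<And>a. a < n \<Longrightarrow> ma a = 0" "\<And>b. b < m \<Longrightarrow> mb b = 0"
  shows "state q ma mb"
  using assms by (auto simp: state_def)

lemma stateD:
  assumes "state q ma mb" "a < n"
  shows "q a \<le> Suc n"
    and "ma a = 0 \<Longrightarrow> q a = 0"
    and "ma a = Suc b \<Longrightarrow> b < m"
    and "ma a = Suc b \<Longrightarrow> adm a b"
    and "ma a = Suc b \<Longrightarrow> a' < n \<Longrightarrow> adm a' b \<Longrightarrow> q a \<le> Suc (q a')"
    and "ma a = Suc b \<Longrightarrow> a' < n \<Longrightarrow> ma a' = Suc b \<Longrightarrow> a = a'"
    and "ma a = Suc b \<Longrightarrow> mb b \<noteq> 0"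
proof -
  have "ma a = Suc b \<Longrightarrow> b < m \<and> adm a b \<and> (\<forall>a'<n. adm a' b \<longrightarrow> q a \<le> Suc (q a'))" for b
    using assms unfolding state_def by blast
  then show "ma a = Suc b \<Longrightarrow> b < m" "ma a = Suc b \<Longrightarrow> adm a b"
    "ma a = Suc b \<Longrightarrow> a' < n \<Longrightarrow> adm a' b \<Longrightarrow> q a \<le> Suc (q a')"
    "ma a = Suc b \<Longrightarrow> mb b \<noteq> 0"
    using assms unfolding state_def by blast+
  have "\<forall>a<n. \<forall>a'<n. ma a = ma a' \<longrightarrow> ma a \<noteq> 0 \<longrightarrow> a = a'"
    using assms(1) unfolding state_def by blast
  then show "ma a = Suc b \<Longrightarrow> a' < n \<Longrightarrow> ma a' = Suc b \<Longrightarrow> a = a'"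
    using assms(2) by simp
qed (use assms in \<open>simp_all add: state_def\<close>)

lemma state_matched: "state q ma mb \<Longrightarrow> b < m \<Longrightarrow> mb b \<noteq> 0 \<longleftrightarrow> (\<exists>a<n. ma a = Suc b)"
  unfolding state_def by blast

text \<open>The price condition in \<open>state\<close> is approximate complementary slackness: an
  object pays at most one more than the price of its cheapest alternative. The bidder satisfies it
  because it picks a cheapest agent, the others because prices never fall.\<close>

lemma state_bid:
  assumes st: "state q ma mb" and b: "b < m" "mb b = 0" and a: "a < n" "adm a b" "q a \<le> n"
    and best: "\<And>a'. a' < n \<Longrightarrow> adm a' b \<Longrightarrow> q a \<le> q a'"
  shows "state (q(a := Suc (q a))) (ma(a := Suc b))
     ((if ma a = 0 then mb else mb(ma a - 1 := 0))(b := 1))"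
    (is "state ?q ?ma ?mb")
proof -
  have free: "ma a' \<noteq> Suc b" if "a' < n" for a'
    using stateD(7)[OF st that] b by blast
  have 1: "?q a1 \<le> Suc n" if "a1 < n" for a1
    using a stateD(1)[OF st that] by simp
  have 2: "?q a1 = 0" if "a1 < n" "?ma a1 = 0" for a1
    using that stateD(2)[OF st that(1)] by (simp split: if_splits)
  have 3: "c < m \<and> adm a1 c" if "a1 < n" "?ma a1 = Suc c" for a1 c
    using that a b stateD(3,4)[OF st that(1)] by (simp split: if_splits)
  have 4: "?q a1 \<le> Suc (?q a2)" if "a1 < n" "?ma a1 = Suc c" "a2 < n" "adm a2 c" for a1 a2 c
  proof (cases "a1 = a")
    case True then show ?thesis using that best by auto
  next
    case False
    then have "q a1 \<le> Suc (q a2)" using that stateD(5)[OF st that(1)] by simp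
    then show ?thesis using False by (cases "a2 = a") auto
  qed
  have 5: "a1 = a2" if less: "a1 < n" "a2 < n" and eq: "?ma a1 = ?ma a2" "?ma a1 \<noteq> 0" for a1 a2
  proof -
    obtain c where c: "?ma a1 = Suc c" using eq(2) not0_implies_Suc by blast
    then have c': "?ma a2 = Suc c" using eq(1) by metis
    show ?thesis
    proof (cases "a1 = a \<or> a2 = a")
      case True
      then show ?thesis using c c' free[OF less(1)] free[OF less(2)] by (auto split: if_splits)
    next
      case False
      then have "ma a1 = Suc c" "ma a2 = Suc c" using c c' by auto
      then show ?thesis using stateD(6)[OF st less(1) _ less(2)] by blast
    qed
  qed
  have 6: "?mb c \<noteq> 0 \<longleftrightarrow> (\<exists>a'<n. ?ma a' = Suc c)" if c: "c < m" for c
  proof (cases "c = b")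
    case True then show ?thesis using a by auto
  next
    case False
    show ?thesis
    proof (cases "ma a = Suc c")
      \<comment> \<open>Here \<open>c\<close> is the object evicted from \<open>a\<close>, who was
        its only holder.\<close>
      case True
      then have "?ma a' \<noteq> Suc c" if "a' < n" for a'
      proof (cases "a' = a")
        case ne: False
        then have "ma a' \<noteq> Suc c" using stateD(6)[OF st a(1) True that] by blast
        then show ?thesis using ne by simp
      qed (use False in simp)
      then show ?thesis using False True by simp
    next
      case ne: False
      then have "?mb c = mb c" using False by (cases "ma a") auto
      moreover have "(\<exists>a'<n. ?ma a' = Suc c) \<longleftrightarrow> (\<exists>a'<n. ma a' = Suc c)"
        using False ne by (intro ex_cong) auto
      ultimately show ?thesis using state_matched[OF st c] by metis
    qed
  qed
  show ?thesis unfolding state_def using 1 2 3 4 5 6 by blast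
qed

text \<open>
  Some price level \<open>k\<close> is not attained. All agents above \<open>k\<close> are matched, and the objects they
  hold compete only for agents above \<open>k\<close>. Hence \<open>b \<mapsto> M (f b)\<close> maps the tight objects among
  them together with \<open>c\<close> injectively to themselves, missing \<open>c\<close>.
\<close>

lemma unmatched_below:
  fixes l l' :: "nat \<Rightarrow> nat" and f :: "nat \<Rightarrow> nat"
  assumes st: "state q ma mb" and c: "c < m" "mb c = 0" and settled: "settled q mb c"
    and f: "inj_on f {..<m}" "\<And>b. b < m \<Longrightarrow> f b < n"
    and le: "\<And>b. b < m \<Longrightarrow> l b \<le> l' b"
    and tight: "\<And>b. b < m \<Longrightarrow> l b = l' b \<Longrightarrow> adm (f b) b"
    and swap: "\<And>b b'. b < m \<Longrightarrow> b' < m \<Longrightarrow> adm (f b) b' \<Longrightarrow> l b = l' b \<Longrightarrow> l b' = l' b'"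
  shows "l c < l' c"
proof (rule ccontr)
  assume "\<not> l c < l' c"
  then have lc: "l c = l' c" using le c by force
  have top: "n < q a" if "a < n" "adm a c" for a
    using settled c that unfolding settled_def by auto
  let ?a0 = "f c"
  have a0: "?a0 < n" "adm ?a0 c" using f c tight lc by auto
  then have qa0: "n < q ?a0" using top by blast
  \<comment> \<open>Pigeonhole: \<open>?a0\<close> is priced above \<open>n\<close>, and the other
    \<open>n - 1\<close> agents cannot attain all of the prices from 1 to \<open>n\<close>.\<close>
  have "\<exists>k. 1 \<le> k \<and> k \<le> n \<and> k \<notin> q ` {..<n}"
  proof (rule ccontr)
    assume "\<not> ?thesis"
    then have "{1..n} \<subseteq> q ` ({..<n} - {?a0})" using qa0 by fastforce
    then have "card {1..n} \<le> card ({..<n} - {?a0})"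
      by (meson card_image_le card_mono finite_Diff finite_imageI finite_lessThan le_trans)
    also have "\<dots> < n" using a0 by simp
    finally show False by simp
  qed
  then obtain k where k: "1 \<le> k" "k \<le> n" "\<And>a. a < n \<Longrightarrow> q a \<noteq> k" by blast
  define T where "T = {b. b < m \<and> l b = l' b \<and> (b = c \<or> (\<exists>a<n. k < q a \<and> ma a = Suc b))}"
  define g where "g b = ma (f b) - 1" for b
  have fin: "finite T" unfolding T_def by simp
  have cT: "c \<in> T" using c lc unfolding T_def by simp
  have key: "g b \<in> T - {c} \<and> ma (f b) = Suc (g b)" if b: "b \<in> T" for b
  proof -
    have bm: "b < m" "l b = l' b" using b unfolding T_def by auto
    then have fb: "f b < n" "adm (f b) b" using f tight by auto
    \<comment> \<open>For \<open>b = c\<close> the price exceeds \<open>n\<close>; otherwise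
      slackness against the holder of \<open>b\<close> loses at most one. As no agent has price
      \<open>k\<close>, the inequality is then strict.\<close>
    have "k \<le> q (f b)"
    proof (cases "b = c")
      case True then show ?thesis using top[OF fb(1)] fb k by auto
    next
      case False
      then obtain a where "a < n" "k < q a" "ma a = Suc b" using b unfolding T_def by auto
      then have "q a \<le> Suc (q (f b))" using stateD(5)[OF st] fb by blast
      then show ?thesis using \<open>k < q a\<close> by simp
    qed
    then have kq: "k < q (f b)" using k(3)[OF fb(1)] by simp
    then have "ma (f b) \<noteq> 0" using stateD(2)[OF st fb(1)] by auto
    then have mg: "ma (f b) = Suc (g b)" unfolding g_def by simp
    then have gb: "g b < m" "adm (f b) (g b)" using stateD(3,4)[OF st fb(1)] by blast+
    have "l (g b) = l' (g b)" using swap[OF bm(1) gb bm(2)] .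
    moreover have "g b \<noteq> c" using stateD(7)[OF st fb(1)] mg c by auto
    ultimately show ?thesis using gb mg kq fb unfolding T_def by auto
  qed
  have "inj_on g T"
  proof (rule inj_onI)
    fix x y assume xy: "x \<in> T" "y \<in> T" "g x = g y"
    then have "ma (f x) = Suc (g x)" "ma (f y) = Suc (g x)" using key by simp_all
    moreover have "x < m" "y < m" using xy unfolding T_def by auto
    ultimately have "f x = f y" using stateD(6)[OF st] f(2) by blast
    then show "x = y" using f(1) \<open>x < m\<close> \<open>y < m\<close> by (auto dest: inj_onD)
  qed
  then have "card T \<le> card (T - {c})"
    using key fin by (metis card_inj_on_le finite_Diff image_subsetI)
  moreover have "card (T - {c}) < card T" using fin cT by (rule card_Diff1_less)
  ultimately show False by simp
qed

text \<open>Each bid raises one price by one, so this bounds the number of bids.\<close>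

lemma sum_prices_le:
  assumes "state q ma mb"
  shows "(\<Sum>a<n. q a) \<le> n * Suc n"
proof -
  have "(\<Sum>a<n. q a) \<le> (\<Sum>a<n. Suc n)"
    using assms unfolding state_def by (intro sum_mono) auto
  then show ?thesis by simp
qed

end

section \<open>The program\<close>

declare sem.simps(5) [simp del]

abbreviation (input) then_syntax :: "prog \<Rightarrow> prog \<Rightarrow> prog" (infixr ";;" 60) where
  "p ;; q \<equiv> Then p q"

abbreviation (input) V :: "nat \<Rightarrow> aexp" where "V x \<equiv> Cell x (Const 0)"

text \<open>
  Names of the arrays. Array \<open>1\<close> is written \<open>Suc 0\<close>, the form to which the simplifier rewrites it.
  As the machine cannot multiply, \<open>MULT\<close> holds the multiples of the number of objects, by which
  the row-major matrices are addressed.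
\<close>

abbreviation (input) LEN :: nat where "LEN \<equiv> Suc 0"
abbreviation (input) AGENTS :: nat where "AGENTS \<equiv> 2"
abbreviation (input) OBJECTS :: nat where "OBJECTS \<equiv> 3"
abbreviation (input) MULT :: nat where "MULT \<equiv> 4"
abbreviation (input) EDGES :: nat where "EDGES \<equiv> 5"
abbreviation (input) FORCED :: nat where "FORCED \<equiv> 6"
abbreviation (input) FORBIDDEN :: nat where "FORBIDDEN \<equiv> 7"
abbreviation (input) PREFS :: nat where "PREFS \<equiv> 8"
abbreviation (input) FLAG :: nat where "FLAG \<equiv> 9"
abbreviation (input) POS :: nat where "POS \<equiv> 10"
abbreviation (input) ROUND1 :: nat where "ROUND1 \<equiv> 11"
abbreviation (input) ROUND2 :: nat where "ROUND2 \<equiv> 12"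
abbreviation (input) PASS1 :: nat where "PASS1 \<equiv> 13"
abbreviation (input) PASS2 :: nat where "PASS2 \<equiv> 14"
abbreviation (input) AA :: nat where "AA \<equiv> 15"
abbreviation (input) BB :: nat where "BB \<equiv> 16"
abbreviation (input) CC :: nat where "CC \<equiv> 17"
abbreviation (input) OK :: nat where "OK \<equiv> 18"
abbreviation (input) ADM :: nat where "ADM \<equiv> 19"
abbreviation (input) LEVEL :: nat where "LEVEL \<equiv> 20"
abbreviation (input) PRICE :: nat where "PRICE \<equiv> 21"
abbreviation (input) HOLDS :: nat where "HOLDS \<equiv> 22"
abbreviation (input) TAKEN :: nat where "TAKEN \<equiv> 23"
abbreviation (input) BEST :: nat where "BEST \<equiv> 24"
abbreviation (input) BESTPRICE :: nat where "BESTPRICE \<equiv> 25"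
abbreviation (input) WINNER :: nat where "WINNER \<equiv> 26"

definition index :: "nat \<Rightarrow> nat \<Rightarrow> aexp" where
  "index a b = Add (Cell MULT (V a)) (V b)"

definition bit_at :: "nat \<Rightarrow> nat \<Rightarrow> nat \<Rightarrow> aexp" where
  "bit_at base a b = Cell 0 (Add (V base) (index a b))"

text \<open>The address \<open>(a * m + b) * m + c\<close> takes a second lookup in
  \<open>MULT\<close>, which must therefore contain the multiples of \<open>m\<close> for all
  factors below \<open>n * m\<close>.\<close>

definition pref_at :: "nat \<Rightarrow> nat \<Rightarrow> nat \<Rightarrow> aexp" where
  "pref_at a b c = Cell 0 (Add (V PREFS) (Add (Cell MULT (index a b)) (V c)))"

text \<open>Truncated subtraction serves as comparison: \<open>Sub x y\<close> is nonzero iff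
  \<open>x\<close> exceeds \<open>y\<close>, and the sum of both differences is nonzero iff the
  operands differ.\<close>

definition scan_step :: prog where
  "scan_step = Cond (bit_at EDGES AA CC)
     (Cond (Sub (Add (Cell LEVEL (V CC)) (pref_at AA CC BB))
                (Add (Cell LEVEL (V BB)) (pref_at AA BB CC)))
        (Assign OK (Const 0) (Const 0))
        (Cond (bit_at FORCED AA CC)
           (Cond (Add (Sub (V BB) (V CC)) (Sub (V CC) (V BB))) (Assign OK (Const 0) (Const 0)) Nop)
           Nop))
     Nop"

definition scan_prog :: prog where
  "scan_prog = Assign OK (Const 0) (Sub (bit_at EDGES AA BB) (bit_at FORBIDDEN AA BB)) ;;
     For CC OBJECTS scan_step"

definition table_prog :: prog where
  "table_prog = For AA AGENTS (For BB OBJECTS (scan_prog ;; Assign ADM (index AA BB) (V OK)))"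

definition reset_prog :: prog where
  "reset_prog = For AA AGENTS (Assign HOLDS (V AA) (Const 0) ;; Assign PRICE (V AA) (Const 0)) ;;
     For BB OBJECTS (Assign TAKEN (V BB) (Const 0))"

text \<open>Starting at \<open>n + 1\<close> and accepting only strict improvements excludes agents
  priced above \<open>n\<close>. \<open>BEST\<close> is the chosen agent plus one, or 0 if there is
  none.\<close>

definition best_prog :: prog where
  "best_prog = Assign BEST (Const 0) (Const 0) ;;
     Assign BESTPRICE (Const 0) (Add (V AGENTS) (Const 1)) ;;
     For AA AGENTS (Cond (Cell ADM (index AA BB))
       (Cond (Sub (V BESTPRICE) (Cell PRICE (V AA)))
          (Assign BESTPRICE (Const 0) (Cell PRICE (V AA)) ;;
           Assign BEST (Const 0) (Add (V AA) (Const 1)))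
          Nop)
       Nop)"

text \<open>The evicted object must be released before \<open>HOLDS\<close> is overwritten.\<close>

definition take_prog :: prog where
  "take_prog = Assign WINNER (Const 0) (Sub (V BEST) (Const 1)) ;;
     Cond (Cell HOLDS (V WINNER))
       (Assign TAKEN (Sub (Cell HOLDS (V WINNER)) (Const 1)) (Const 0)) Nop ;;
     Assign HOLDS (V WINNER) (Add (V BB) (Const 1)) ;;
     Assign TAKEN (V BB) (Const 1) ;;
     Assign PRICE (V WINNER) (Add (Cell PRICE (V WINNER)) (Const 1))"

definition bid_prog :: prog where
  "bid_prog = Cond (Cell TAKEN (V BB)) Nop (best_prog ;; Cond (V BEST) take_prog Nop)"

definition pass_prog :: prog where
  "pass_prog = For BB OBJECTS bid_prog"

definition auction_prog :: prog where
  "auction_prog = For PASS1 LEN (For PASS2 LEN pass_prog)"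

definition raise_prog :: prog where
  "raise_prog = For BB OBJECTS (Cond (Cell TAKEN (V BB)) Nop
     (Assign LEVEL (V BB) (Add (Cell LEVEL (V BB)) (Const 1))))"

definition main_prog :: prog where
  "main_prog = For ROUND1 LEN (For ROUND2 LEN
     (table_prog ;; reset_prog ;; auction_prog ;; raise_prog))"

text \<open>An auction that matches all objects yields an injection into the agents; it is a perfect
  matching only if the two numbers agree, hence the first test.\<close>

definition answer_prog :: prog where
  "answer_prog = Assign OK (Const 0) (Const 1) ;;
     Cond (Add (Sub (V AGENTS) (V OBJECTS)) (Sub (V OBJECTS) (V AGENTS)))
       (Assign OK (Const 0) (Const 0)) Nop ;;
     For BB OBJECTS (Cond (Cell TAKEN (V BB)) Nop (Assign OK (Const 0) (Const 0))) ;;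
     Assign 0 (Const 0) (V OK)"

lemmas prog_defs = scan_step_def scan_prog_def table_prog_def reset_prog_def best_prog_def
  take_prog_def bid_prog_def pass_prog_def auction_prog_def raise_prog_def

lemma index_inject:
  fixes a b k j m :: nat
  assumes "b < m" "j < m"
  shows "a * m + b = k * m + j \<longleftrightarrow> a = k \<and> b = j"
proof
  assume "a * m + b = k * m + j"
  then have "(a * m + b) div m = (k * m + j) div m" "(a * m + b) mod m = (k * m + j) mod m"
    by simp_all
  then show "a = k \<and> b = j" using assms by auto
qed simp

lemma index_less:
  fixes a b m n :: nat
  assumes "a < n" "b < m"
  shows "a * m + b < n * m"
proof -
  have "a * m + b < Suc a * m" using assms by simp
  also have "\<dots> \<le> n * m" using assms by (intro mult_right_mono) auto
  finally show ?thesis .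
qed

section \<open>The stored instance and its table of admissible edges\<close>

locale instance_data =
  fixes n m K :: nat
    and Ed Fp Fm :: "nat \<Rightarrow> nat \<Rightarrow> bool"
    and Pr :: "nat \<Rightarrow> nat \<Rightarrow> nat \<Rightarrow> bool"
begin

definition inst :: "store \<Rightarrow> bool" where
  "inst s \<longleftrightarrow> s LEN 0 = K \<and> s AGENTS 0 = n \<and> s OBJECTS 0 = m \<and>
     (\<forall>a<n. s MULT a = a * m) \<and>
     (\<forall>a<n. \<forall>b<m. s 0 (s EDGES 0 + (a * m + b)) = of_bool (Ed a b) \<and>
        s 0 (s FORCED 0 + (a * m + b)) = of_bool (Fp a b) \<and>
        s 0 (s FORBIDDEN 0 + (a * m + b)) = of_bool (Fm a b) \<and>
        (\<forall>c<m. s 0 (s PREFS 0 + (s MULT (a * m + b) + c)) = of_bool (Pr a b c)))"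

text \<open>The instance lives in arrays 0 to 8 and the working variables have larger names, so a
  phase that writes only the latter preserves \<open>inst\<close>.\<close>

lemma inst_cong:
  assumes "inst s" "\<And>x. x \<le> 8 \<Longrightarrow> s' x = s x"
  shows "inst s'"
  using assms(1) unfolding inst_def by (simp add: assms(2))

lemma inst_upd:
  assumes "inst s" "8 < x"
  shows "inst (upd x i v s)"
proof (rule inst_cong[OF assms(1)])
  show "upd x i v s y = s y" if "y \<le> 8" for y
    using assms(2) that by (intro upd_other) simp
qed

lemma inst_sem: "inst s \<Longrightarrow> writes p \<subseteq> {9..} \<Longrightarrow> inst (sem p s)"
  by (erule inst_cong, rule sem_frame) auto

lemma inst_size: "inst s \<Longrightarrow> s LEN 0 = K \<and> s AGENTS 0 = n \<and> s OBJECTS 0 = m"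
  by (simp add: inst_def)

text \<open>Neighbor \<open>c\<close> rules out giving \<open>b\<close> to \<open>a\<close>. The two
  halves of the vote stand on opposite sides so that the certificate inequality can be stated for
  natural numbers.\<close>

definition bad :: "(nat \<Rightarrow> nat) \<Rightarrow> nat \<Rightarrow> nat \<Rightarrow> nat \<Rightarrow> bool" where
  "bad l a b c \<longleftrightarrow> Ed a c \<and>
     (l b + of_bool (Pr a b c) < l c + of_bool (Pr a c b) \<or> Fp a c \<and> b \<noteq> c)"

definition adm :: "(nat \<Rightarrow> nat) \<Rightarrow> nat \<Rightarrow> nat \<Rightarrow> bool" where
  "adm l a b \<longleftrightarrow> Ed a b \<and> \<not> Fm a b \<and> (\<forall>c<m. \<not> bad l a b c)"

abbreviation "state l \<equiv> auction.state n m (adm l)"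
abbreviation "settled l \<equiv> auction.settled n (adm l)"

lemma sem_scan_step:
  assumes "inst s" "s AA 0 = a" "a < n" "s BB 0 = b" "b < m" "s CC 0 = c" "c < m"
  shows "sem scan_step s = (if bad (s LEVEL) a b c then upd OK 0 0 s else s)"
proof -
  have "aval (bit_at EDGES AA CC) s = of_bool (Ed a c)"
    "aval (bit_at FORCED AA CC) s = of_bool (Fp a c)"
    "aval (pref_at AA CC BB) s = of_bool (Pr a c b)"
    "aval (pref_at AA BB CC) s = of_bool (Pr a b c)"
    using assms by (simp_all add: bit_at_def pref_at_def index_def inst_def)
  then show ?thesis
    using assms by (auto simp: scan_step_def bad_def)
qed

lemma sem_scan_prog:
  assumes s: "inst s" "s AA 0 = a" "a < n" "s BB 0 = b" "b < m"
  shows "sem scan_prog s OK 0 \<noteq> 0 \<longleftrightarrow> adm (s LEVEL) a b"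
proof -
  let ?s = "upd OK 0 (of_bool (Ed a b \<and> \<not> Fm a b)) s"
  define I where "I k s' \<longleftrightarrow> inst s' \<and> s' AA 0 = a \<and> s' BB 0 = b \<and> s' LEVEL = s LEVEL \<and>
    (s' OK 0 \<noteq> 0 \<longleftrightarrow> Ed a b \<and> \<not> Fm a b \<and> (\<forall>c<k. \<not> bad (s LEVEL) a b c))" for k s'
  have "aval (Sub (bit_at EDGES AA BB) (bit_at FORBIDDEN AA BB)) s = of_bool (Ed a b \<and> \<not> Fm a b)"
    using s by (simp add: bit_at_def index_def inst_def)
  then have eq: "sem scan_prog s = sem (For CC OBJECTS scan_step) ?s"
    by (simp add: scan_prog_def)
  have "I (?s OBJECTS 0) (sem (For CC OBJECTS scan_step) ?s)"
  proof (rule For_invariant)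
    show "I 0 (upd CC 0 0 ?s)"
      using s by (simp add: I_def inst_upd upd_apply)
  next
    fix k s' assume k: "k < ?s OBJECTS 0" and I: "I k s'" and c: "s' CC 0 = k"
    have km: "k < m" using k s by (simp add: upd_apply inst_def)
    have "sem scan_step s' = (if bad (s LEVEL) a b k then upd OK 0 0 s' else s')"
      using I s km c sem_scan_step[of s' a b k] by (simp add: I_def)
    then show "I (Suc k) (upd CC 0 (Suc k) (sem scan_step s'))"
      using I unfolding I_def by (auto simp: inst_upd upd_apply less_Suc_eq)
  qed
  moreover have "?s OBJECTS 0 = m" using s by (simp add: upd_apply inst_def)
  ultimately show ?thesis unfolding eq I_def adm_def by simp
qed

definition table :: "store \<Rightarrow> bool" where
  "table s \<longleftrightarrow> (\<forall>a<n. \<forall>b<m. s ADM (a * m + b) \<noteq> 0 \<longleftrightarrow> adm (s LEVEL) a b)"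

lemma writes_scan_prog: "writes scan_prog = {OK, CC}"
  by (auto simp: prog_defs)

lemma sem_table_prog:
  assumes s: "inst s"
  shows "table (sem table_prog s)"
proof -
  let ?body = "scan_prog ;; Assign ADM (index AA BB) (V OK)"
  \<comment> \<open>\<open>T R\<close> says that the table is correct on the region
    \<open>R\<close>: the completed rows, and within a row also its first \<open>j\<close>
    entries.\<close>
  define T where "T R s' \<longleftrightarrow> inst s' \<and> s' LEVEL = s LEVEL \<and>
    (\<forall>a b. R a b \<and> a < n \<and> b < m \<longrightarrow> (s' ADM (a * m + b) \<noteq> 0 \<longleftrightarrow> adm (s LEVEL) a b))"
    for R :: "nat \<Rightarrow> nat \<Rightarrow> bool" and s'
  have T_upd: "T R (upd x i v s')" if "T R s'" "8 < x" "x \<noteq> ADM" "x \<noteq> LEVEL" for R x i v s'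
    using that by (simp add: T_def inst_upd)
  have T_mono: "T R s'" if "T R' s'" "\<And>a b. R a b \<Longrightarrow> a < n \<Longrightarrow> b < m \<Longrightarrow> R' a b" for R R' s'
    using that unfolding T_def by blast
  have row: "T (\<lambda>a b. a < Suc k) (sem (For BB OBJECTS ?body) s')"
    if T: "T (\<lambda>a b. a < k) s'" and k: "k < n" "s' AA 0 = k" for k s'
  proof -
    let ?R = "\<lambda>j a b. a < k \<or> a = k \<and> b < j"
    define I where "I j u \<longleftrightarrow> T (?R j) u \<and> u AA 0 = k" for j u
    have "I (s' OBJECTS 0) (sem (For BB OBJECTS ?body) s')"
    proof (rule For_invariant)
      show "I 0 (upd BB 0 0 s')"
        using T_upd[OF T_mono[OF T, of "?R 0"]] k by (simp add: I_def upd_apply)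
    next
      fix j u assume j: "j < s' OBJECTS 0" and I: "I j u" and b: "u BB 0 = j"
      have jm: "j < m" using j T by (simp add: T_def inst_def)
      have Tu: "T (?R j) u" "inst u" using I by (auto simp: I_def T_def)
      let ?u = "sem scan_prog u"
      have fr: "?u x = u x" if "x \<noteq> OK" "x \<noteq> CC" for x
        using that by (simp add: sem_frame writes_scan_prog)
      have "?u MULT (?u AA 0) + ?u BB 0 = k * m + j"
        using I b Tu k by (simp add: fr I_def inst_def)
      then have eq: "sem ?body u = upd ADM (k * m + j) (?u OK 0) ?u"
        by (simp add: index_def)
      have "?u OK 0 \<noteq> 0 \<longleftrightarrow> adm (u LEVEL) k j"
        using sem_scan_prog[OF Tu(2) _ k(1) b jm] I by (simp add: I_def)
      moreover have "inst ?u" using Tu by (intro inst_sem) (auto simp: writes_scan_prog)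
      ultimately have "T (?R (Suc j)) (sem ?body u)"
        using Tu(1) unfolding T_def eq
        by (auto simp: inst_upd fr upd_apply less_Suc_eq index_inject jm)
      then show "I (Suc j) (upd BB 0 (Suc j) (sem ?body u))"
        using T_upd I unfolding I_def eq by (simp add: upd_apply fr)
    qed
    moreover have "s' OBJECTS 0 = m" using T by (simp add: T_def inst_def)
    ultimately have "T (?R m) (sem (For BB OBJECTS ?body) s')" by (simp only: I_def)
    then show ?thesis by (rule T_mono) auto
  qed
  have "T (\<lambda>a b. a < s AGENTS 0) (sem table_prog s)"
    unfolding table_prog_def
  proof (rule For_invariant)
    show "T (\<lambda>a b. a < 0) (upd AA 0 0 s)"
      using s by (simp add: T_def inst_upd)
  next
    fix k s' assume "k < s AGENTS 0" "T (\<lambda>a b. a < k) s'" "s' AA 0 = k"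
    then show "T (\<lambda>a b. a < Suc k) (upd AA 0 (Suc k) (sem (For BB OBJECTS ?body) s'))"
      using row s by (intro T_upd) (auto simp: inst_def)
  qed
  then show ?thesis using s by (auto simp: table_def T_def inst_def)
qed

section \<open>The auction as run by the machine\<close>

lemma sem_best_prog:
  assumes s: "inst s" "table s" "s BB 0 = b" "b < m"
  shows "case sem best_prog s BEST 0 of
      0 \<Rightarrow> \<forall>a<n. adm (s LEVEL) a b \<longrightarrow> n < s PRICE a
    | Suc a \<Rightarrow> a < n \<and> adm (s LEVEL) a b \<and> s PRICE a \<le> n \<and>
        (\<forall>a'<n. adm (s LEVEL) a' b \<longrightarrow> s PRICE a \<le> s PRICE a')"
proof -
  let ?adm = "adm (s LEVEL)"
  let ?body = "Cond (Cell ADM (index AA BB))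
       (Cond (Sub (V BESTPRICE) (Cell PRICE (V AA)))
          (Assign BESTPRICE (Const 0) (Cell PRICE (V AA)) ;;
           Assign BEST (Const 0) (Add (V AA) (Const 1)))
          Nop)
       Nop"
  define I where "I k u \<longleftrightarrow> inst u \<and> u ADM = s ADM \<and> u PRICE = s PRICE \<and> u BB 0 = b \<and>
    u BESTPRICE 0 \<le> Suc n \<and> (\<forall>a<k. ?adm a b \<longrightarrow> u BESTPRICE 0 \<le> s PRICE a) \<and>
    (case u BEST 0 of 0 \<Rightarrow> u BESTPRICE 0 = Suc n
     | Suc a \<Rightarrow> a < n \<and> ?adm a b \<and> s PRICE a = u BESTPRICE 0 \<and> s PRICE a \<le> n)" for k u
  let ?s = "upd BESTPRICE 0 (Suc n) (upd BEST 0 0 s)"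
  have eq: "sem best_prog s = sem (For AA AGENTS ?body) ?s"
    using s by (simp add: best_prog_def upd_apply inst_def)
  have "I (?s AGENTS 0) (sem (For AA AGENTS ?body) ?s)"
  proof (rule For_invariant)
    show "I 0 (upd AA 0 0 ?s)"
      using s by (simp add: I_def inst_upd upd_apply)
  next
    fix k u assume k: "k < ?s AGENTS 0" and I: "I k u" and a: "u AA 0 = k"
    have kn: "k < n" using k s by (simp add: upd_apply inst_def)
    have adm: "u ADM (u MULT (u AA 0) + u BB 0) \<noteq> 0 \<longleftrightarrow> ?adm k b"
      using I a kn s by (simp add: I_def inst_def table_def)
    have "sem ?body u = (if ?adm k b \<and> s PRICE k < u BESTPRICE 0
      then upd BEST 0 (Suc k) (upd BESTPRICE 0 (s PRICE k) u) else u)"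
      using adm I a by (auto simp: index_def upd_apply I_def)
    then show "I (Suc k) (upd AA 0 (Suc k) (sem ?body u))"
      using I kn unfolding I_def
      by (auto simp: inst_upd upd_apply less_Suc_eq split: nat.splits)
  qed
  moreover have "?s AGENTS 0 = n" using s by (simp add: upd_apply inst_def)
  ultimately have "I n (sem best_prog s)" unfolding eq by simp
  then show ?thesis by (auto simp: I_def Suc_le_eq split: nat.splits)
qed

lemma writes_best_prog: "writes best_prog = {BEST, BESTPRICE, AA}"
  by (auto simp: prog_defs)

text \<open>The sum of the prices is the progress measure: it grows by one unless the object is
  already settled.\<close>

lemma sem_bid_prog:
  assumes s: "inst s" "table s" "state (s LEVEL) (s PRICE) (s HOLDS) (s TAKEN)"
    and b: "s BB 0 = b" "b < m"
  defines "s' \<equiv> sem bid_prog s"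
  shows "state (s LEVEL) (s' PRICE) (s' HOLDS) (s' TAKEN)"
    and "if settled (s LEVEL) (s PRICE) (s TAKEN) b
      then s' PRICE = s PRICE \<and> s' TAKEN = s TAKEN
      else (\<Sum>a<n. s' PRICE a) = Suc (\<Sum>a<n. s PRICE a)"
proof -
  let ?adm = "adm (s LEVEL)" and ?u = "sem best_prog s"
  have fr: "?u x = s x" if "x \<noteq> BEST" "x \<noteq> BESTPRICE" "x \<noteq> AA" for x
    using that by (simp add: sem_frame writes_best_prog)
  note best = sem_best_prog[OF s(1,2) b]
  have "state (s LEVEL) (s' PRICE) (s' HOLDS) (s' TAKEN) \<and>
    (if settled (s LEVEL) (s PRICE) (s TAKEN) b
      then s' PRICE = s PRICE \<and> s' TAKEN = s TAKEN
      else (\<Sum>a<n. s' PRICE a) = Suc (\<Sum>a<n. s PRICE a))"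
  proof (cases "s TAKEN b = 0")
    case False
    then have "s' = s" using b by (simp add: s'_def bid_prog_def)
    then show ?thesis using s(3) False by (simp add: auction.settled_def)
  next
    case free: True
    show ?thesis
    proof (cases "?u BEST 0")
      case 0
      then have s': "s' = ?u" using b free by (simp add: s'_def bid_prog_def)
      have "settled (s LEVEL) (s PRICE) (s TAKEN) b"
        using best 0 by (simp add: auction.settled_def)
      then show ?thesis using s(3) by (simp add: s' fr)
    next
      case (Suc a)
      then have a: "a < n" "?adm a b" "s PRICE a \<le> n"
        "\<And>a'. a' < n \<Longrightarrow> ?adm a' b \<Longrightarrow> s PRICE a \<le> s PRICE a'"
        using best by auto
      have s': "s' = sem take_prog ?u" using b free Suc by (simp add: s'_def bid_prog_def)
      have arrays: "s' PRICE = (s PRICE)(a := Suc (s PRICE a))"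
        "s' HOLDS = (s HOLDS)(a := Suc b)"
        "s' TAKEN = ((if s HOLDS a = 0 then s TAKEN else (s TAKEN)(s HOLDS a - 1 := 0))(b := 1))"
        unfolding s' take_prog_def using Suc b
        by (simp_all add: upd_apply fr fun_eq_iff)
      have "state (s LEVEL) (s' PRICE) (s' HOLDS) (s' TAKEN)"
        unfolding arrays using auction.state_bid[OF s(3) b(2) free a] by simp
      moreover have "\<not> settled (s LEVEL) (s PRICE) (s TAKEN) b"
        using free a by (auto simp: auction.settled_def)
      moreover have "(\<Sum>a<n. s' PRICE a) = Suc (\<Sum>a<n. s PRICE a)"
        unfolding arrays using a(1) by (simp add: sum.remove[of "{..<n}" a])
      ultimately show ?thesis by simp
    qed
  qed
  then show "state (s LEVEL) (s' PRICE) (s' HOLDS) (s' TAKEN)"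
    "if settled (s LEVEL) (s PRICE) (s TAKEN) b
      then s' PRICE = s PRICE \<and> s' TAKEN = s TAKEN
      else (\<Sum>a<n. s' PRICE a) = Suc (\<Sum>a<n. s PRICE a)" by auto
qed

lemma writes_bid_prog:
  "writes bid_prog = {BEST, BESTPRICE, AA, WINNER, TAKEN, HOLDS, PRICE}"
  by (auto simp: prog_defs)

definition running :: "(nat \<Rightarrow> nat) \<Rightarrow> store \<Rightarrow> bool" where
  "running l s \<longleftrightarrow> inst s \<and> table s \<and> s LEVEL = l \<and> state l (s PRICE) (s HOLDS) (s TAKEN)"

lemma running_upd:
  "running l s \<Longrightarrow> x \<in> {PASS1, PASS2, BB} \<Longrightarrow> running l (upd x i v s)"
  by (auto simp: running_def inst_upd table_def)

lemma running_bid_prog: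
  assumes "running l s" "s BB 0 = b" "b < m"
  shows "running l (sem bid_prog s)"
proof -
  have "inst (sem bid_prog s)"
    using assms(1) by (intro inst_sem) (auto simp: running_def writes_bid_prog)
  then show ?thesis
    using assms sem_bid_prog(1)[of s b]
    by (simp add: running_def table_def sem_frame writes_bid_prog)
qed

text \<open>If some object is unsettled when the pass begins, the first such object meets unchanged
  prices and bids; otherwise the pass changes neither prices nor \<open>TAKEN\<close>.\<close>

lemma sem_pass_prog:
  assumes run: "running l s"
    and progress: "(\<forall>b<m. settled l (s PRICE) (s TAKEN) b) \<or> k \<le> (\<Sum>a<n. s PRICE a)"
  defines "s' \<equiv> sem pass_prog s"
  shows "running l s'"
    and "(\<forall>b<m. settled l (s' PRICE) (s' TAKEN) b) \<or> Suc k \<le> (\<Sum>a<n. s' PRICE a)"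
proof -
  define I where "I j u \<longleftrightarrow> running l u \<and>
    (u PRICE = s PRICE \<and> u TAKEN = s TAKEN \<and> (\<forall>b<j. settled l (s PRICE) (s TAKEN) b) \<or>
     Suc k \<le> (\<Sum>a<n. u PRICE a))" for j u
  have "I (s OBJECTS 0) s'"
    unfolding s'_def pass_prog_def
  proof (rule For_invariant)
    show "I 0 (upd BB 0 0 s)"
      using running_upd[OF run] by (simp add: I_def)
  next
    fix j u assume j: "j < s OBJECTS 0" and I: "I j u" and b: "u BB 0 = j"
    have jm: "j < m" using j run by (simp add: running_def inst_def)
    let ?u = "sem bid_prog u"
    have u: "running l u" using I by (simp add: I_def)
    have eff: "if settled l (u PRICE) (u TAKEN) j
      then ?u PRICE = u PRICE \<and> ?u TAKEN = u TAKEN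
      else (\<Sum>a<n. ?u PRICE a) = Suc (\<Sum>a<n. u PRICE a)"
      using u sem_bid_prog(2)[of u j] b jm by (simp add: running_def)
    have "?u PRICE = s PRICE \<and> ?u TAKEN = s TAKEN \<and> (\<forall>b<Suc j. settled l (s PRICE) (s TAKEN) b) \<or>
      Suc k \<le> (\<Sum>a<n. ?u PRICE a)"
    proof (cases "Suc k \<le> (\<Sum>a<n. u PRICE a)")
      case True
      then show ?thesis using eff by (auto split: if_splits)
    next
      case False
      then have same: "u PRICE = s PRICE" "u TAKEN = s TAKEN"
        "\<forall>b<j. settled l (s PRICE) (s TAKEN) b" using I by (auto simp: I_def)
      show ?thesis
      proof (cases "settled l (s PRICE) (s TAKEN) j")
        case True
        then show ?thesis using same eff by (auto simp: less_Suc_eq)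
      next
        case False
        then have "k \<le> (\<Sum>a<n. s PRICE a)" using progress jm by blast
        then show ?thesis using same eff False by simp
      qed
    qed
    then show "I (Suc j) (upd BB 0 (Suc j) ?u)"
      using running_upd[OF running_bid_prog[OF u b jm]] by (simp add: I_def)
  qed
  then have "I m s'" using run by (simp add: running_def inst_def)
  then show "running l s'"
    "(\<forall>b<m. settled l (s' PRICE) (s' TAKEN) b) \<or> Suc k \<le> (\<Sum>a<n. s' PRICE a)"
    by (auto simp: I_def)
qed

lemma sem_auction_prog:
  assumes run: "running l s" and K: "n < K"
  defines "s' \<equiv> sem auction_prog s"
  shows "running l s'" and "\<forall>b<m. settled l (s' PRICE) (s' TAKEN) b"
proof -
  define I where "I k u \<longleftrightarrow> running l u \<and>
    ((\<forall>b<m. settled l (u PRICE) (u TAKEN) b) \<or> k \<le> (\<Sum>a<n. u PRICE a))" for k u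
  have I: "I (K * K) s'"
    unfolding s'_def auction_prog_def
  proof (rule For_For_invariant)
    show "I 0 s" using run by (simp add: I_def)
    show "u LEN 0 = K" if "I k u" for k u using that by (simp add: I_def running_def inst_def)
    show "I k (upd PASS1 0 v u)" "I k (upd PASS2 0 v u)" if "I k u" for k u v
      using that running_upd by (simp_all add: I_def)
    show "I (Suc k) (sem pass_prog u)" if "I k u" for k u
      using that sem_pass_prog[of l u k] by (simp add: I_def)
  qed
  then show run': "running l s'" by (simp add: I_def)
  \<comment> \<open>The sum of prices cannot reach \<open>K * K\<close>, which leaves only the
    alternative that all objects are settled.\<close>
  have "(\<Sum>a<n. s' PRICE a) \<le> n * Suc n"
    using run' auction.sum_prices_le by (auto simp: running_def)
  also have "\<dots> < K * K" using K by (intro mult_less_le_imp_less) auto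
  finally show "\<forall>b<m. settled l (s' PRICE) (s' TAKEN) b"
    using I by (auto simp: I_def)
qed

lemma sem_reset_prog:
  assumes s: "inst s" "table s"
  shows "running (s LEVEL) (sem reset_prog s)"
proof -
  let ?A = "Assign HOLDS (V AA) (Const 0) ;; Assign PRICE (V AA) (Const 0)"
  let ?p = "For AA AGENTS ?A" and ?q = "For BB OBJECTS (Assign TAKEN (V BB) (Const 0))"
  define I where "I k u \<longleftrightarrow> (\<forall>a<k. u HOLDS a = (0::nat) \<and> u PRICE a = (0::nat))"
    for k and u :: store
  define J where "J k u \<longleftrightarrow> (\<forall>b<k. u TAKEN b = (0::nat))" for k and u :: store
  let ?u = "sem ?p s"
  have I: "I (s AGENTS 0) ?u"
    by (rule For_invariant) (auto simp: I_def upd_apply less_Suc_eq)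
  have J: "J (?u OBJECTS 0) (sem ?q ?u)"
    by (rule For_invariant) (auto simp: J_def upd_apply less_Suc_eq)
  have fr: "?u x = s x" if "x \<noteq> AA" "x \<noteq> HOLDS" "x \<noteq> PRICE" for x
    using that by (simp add: sem_frame)
  have fr': "sem ?q ?u x = ?u x" if "x \<noteq> BB" "x \<noteq> TAKEN" for x
    using that by (simp add: sem_frame)
  have eq: "sem reset_prog s = sem ?q ?u" by (simp add: reset_prog_def)
  have "state (s LEVEL) (sem reset_prog s PRICE) (sem reset_prog s HOLDS) (sem reset_prog s TAKEN)"
    by (rule auction.state_initial)
      (use I J s in \<open>auto simp: I_def J_def eq fr fr' inst_def\<close>)
  moreover have "inst (sem reset_prog s)"
    using s(1) by (rule inst_sem) (auto simp: prog_defs)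
  ultimately show ?thesis using s(2) by (auto simp: running_def table_def eq fr fr')
qed

section \<open>Raising the levels of unmatched objects\<close>

lemma sem_raise_prog:
  assumes s: "inst s"
  shows "\<forall>b<m. sem raise_prog s LEVEL b = s LEVEL b + of_bool (s TAKEN b = 0)"
proof -
  let ?body = "Cond (Cell TAKEN (V BB)) Nop
     (Assign LEVEL (V BB) (Add (Cell LEVEL (V BB)) (Const 1)))"
  define I where "I k u \<longleftrightarrow> u TAKEN = s TAKEN \<and>
    (\<forall>b. u LEVEL b = s LEVEL b + of_bool (b < k \<and> s TAKEN b = 0))" for k and u :: store
  have "I (s OBJECTS 0) (sem raise_prog s)"
    unfolding raise_prog_def
  proof (rule For_invariant)
    show "I 0 (upd BB 0 0 s)" by (simp add: I_def upd_def)
  next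
    fix k u assume "I k u" "u BB 0 = k"
    then show "I (Suc k) (upd BB 0 (Suc k) (sem ?body u))"
      by (auto simp: I_def upd_apply less_Suc_eq)
  qed
  then show ?thesis using s by (simp add: I_def inst_def)
qed

text \<open>The map goes from objects to agents because the objects bid; its inverse is the matching
  once \<open>n = m\<close>.\<close>

definition solves :: "(nat \<Rightarrow> nat) \<Rightarrow> (nat \<Rightarrow> nat) \<Rightarrow> bool" where
  "solves l f \<longleftrightarrow> inj_on f {..<m} \<and> (\<forall>b<m. f b < n \<and> adm l (f b) b)"

lemma solves_cong: "(\<And>b. b < m \<Longrightarrow> l b = l' b) \<Longrightarrow> solves l f \<longleftrightarrow> solves l' f"
  by (simp add: solves_def adm_def bad_def cong: conj_cong)

lemma solves_unmatched_below:
  assumes st: "state l q h t" and c: "c < m" "t c = 0" "settled l q t c"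
    and f: "solves l' f" and le: "\<And>b. b < m \<Longrightarrow> l b \<le> l' b"
  shows "l c < l' c"
proof (rule auction.unmatched_below[OF st c])
  show "inj_on f {..<m}" "\<And>b. b < m \<Longrightarrow> f b < n" using f by (auto simp: solves_def)
  show "l b \<le> l' b" if "b < m" for b using le that .
  \<comment> \<open>With the level of \<open>b\<close> kept, lowering those of other objects only
    weakens the inequalities at \<open>b\<close>.\<close>
  show "adm l (f b) b" if b: "b < m" "l b = l' b" for b
  proof -
    have adm: "adm l' (f b) b" using f b by (simp add: solves_def)
    have "\<not> bad l (f b) b d" if d: "d < m" for d
      using adm d b(2) le[OF d] by (fastforce simp: adm_def bad_def)
    then show ?thesis using adm by (simp add: adm_def)
  qed
  \<comment> \<open>Admissibility of \<open>b\<close> for \<open>l'\<close> and of \<open>d\<close>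
    for \<open>l\<close>, both at agent \<open>f b\<close>, give opposite inequalities with the same
    votes; since \<open>l b = l' b\<close>, they yield \<open>l' d \<le> l d\<close>.\<close>
  show "l d = l' d" if b: "b < m" "d < m" "adm l (f b) d" "l b = l' b" for b d
  proof -
    have "adm l' (f b) b" using f b by (simp add: solves_def)
    then have "\<not> bad l' (f b) b d" "\<not> bad l (f b) d b" "Ed (f b) b" "Ed (f b) d"
      using b by (auto simp: adm_def)
    then show ?thesis using b(4) le[OF b(2)] by (auto simp: bad_def)
  qed
qed

lemma full_solves:
  assumes st: "state l q h t" and full: "\<forall>b<m. t b \<noteq> 0"
  shows "\<exists>f. solves l f"
proof -
  have "\<forall>b<m. \<exists>a<n. h a = Suc b" using full auction.state_matched[OF st] by blast
  then obtain f where f: "\<And>b. b < m \<Longrightarrow> f b < n \<and> h (f b) = Suc b" by metis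
  have "inj_on f {..<m}"
    by (intro inj_onI) (metis f lessThan_iff nat.inject)
  moreover have "adm l (f b) b" if "b < m" for b
    using auction.stateD(4)[OF st] f[OF that] by blast
  ultimately show ?thesis using f by (auto simp: solves_def)
qed

abbreviation (input) full :: "store \<Rightarrow> bool" where "full s \<equiv> \<forall>b<m. s TAKEN b \<noteq> 0"

text \<open>The levels never exceed those of any solution, while every round that leaves an object
  unmatched increases their sum. The link from \<open>full\<close> to \<open>solves\<close> makes
  success persist through the remaining rounds.\<close>

definition main_inv :: "nat \<Rightarrow> store \<Rightarrow> bool" where
  "main_inv k s \<longleftrightarrow> inst s \<and> (\<forall>l f. solves l f \<longrightarrow> (\<forall>b<m. s LEVEL b \<le> l b)) \<and>
     (full s \<longrightarrow> (\<exists>f. solves (s LEVEL) f)) \<and> (full s \<or> k \<le> (\<Sum>b<m. s LEVEL b))"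

lemma main_inv_step:
  assumes inv: "main_inv k s" and K: "n < K"
  shows "main_inv (Suc k) (sem (table_prog ;; reset_prog ;; auction_prog ;; raise_prog) s)"
    (is "main_inv _ ?s'")
proof -
  let ?l = "s LEVEL"
  define t where "t = sem table_prog s"
  define r where "r = sem reset_prog t"
  define u where "u = sem auction_prog r"
  have s: "inst s" using inv by (simp add: main_inv_def)
  have t: "inst t" "table t" "t LEVEL = ?l"
    using s sem_table_prog by (auto simp: t_def sem_frame prog_defs intro!: inst_sem)
  have "running ?l r" using sem_reset_prog[OF t(1,2)] t(3) by (simp add: r_def)
  from sem_auction_prog[OF this K]
  have u: "inst u" "u LEVEL = ?l" "state ?l (u PRICE) (u HOLDS) (u TAKEN)"
    "\<forall>b<m. settled ?l (u PRICE) (u TAKEN) b"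
    by (auto simp: u_def running_def)
  have s': "?s' = sem raise_prog u" by (simp add: t_def r_def u_def)
  have l': "\<And>b. b < m \<Longrightarrow> ?s' LEVEL b = ?l b + of_bool (u TAKEN b = 0)"
    using sem_raise_prog[OF u(1)] u(2) unfolding s' by simp
  have taken: "?s' TAKEN = u TAKEN" unfolding s' by (simp add: sem_frame prog_defs)
  have inst': "inst ?s'" unfolding s' using u(1) by (rule inst_sem) (auto simp: prog_defs)
  have below: "?l b < l b" if "solves l f" "\<And>b. b < m \<Longrightarrow> ?l b \<le> l b" "b < m" "u TAKEN b = 0"
    for l f b
    using solves_unmatched_below[OF u(3) that(3,4) _ that(1,2)] u(4) that(3) by blast
  have "?s' LEVEL b \<le> l b" if sol: "solves l f" and b: "b < m" for l f b
  proof -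
    have le: "?l b \<le> l b" if "b < m" for b
      using inv sol that unfolding main_inv_def by blast
    show ?thesis using le[OF b] below[OF sol le b] l'[OF b] by auto
  qed
  moreover have "\<exists>f. solves (?s' LEVEL) f" if f': "full ?s'"
  proof -
    have f: "full u" using f' unfolding taken .
    then have "solves (?s' LEVEL) f \<longleftrightarrow> solves ?l f" for f
      using l' by (intro solves_cong) simp
    then show ?thesis using full_solves[OF u(3) f] by blast
  qed
  moreover have "Suc k \<le> (\<Sum>b<m. ?s' LEVEL b)" if not_full: "\<not> full ?s'"
  proof -
    obtain c where c: "c < m" "u TAKEN c = 0" using not_full unfolding taken by blast
    \<comment> \<open>Had the table been full before, the current levels would be a solution, and
      \<open>below\<close> applied to them would give \<open>?l c < ?l c\<close>.\<close>
    have "\<not> full s"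
    proof
      assume "full s"
      then obtain f where "solves ?l f" using inv unfolding main_inv_def by blast
      from below[OF this _ c] show False by simp
    qed
    then have "k \<le> (\<Sum>b<m. ?l b)" using inv unfolding main_inv_def by blast
    also have "\<dots> < (\<Sum>b<m. ?s' LEVEL b)"
      using c l' by (intro sum_strict_mono_ex1) auto
    finally show ?thesis by simp
  qed
  ultimately show ?thesis using inst' unfolding main_inv_def by blast
qed

lemma sem_main_prog:
  assumes s: "inst s" "\<And>b. s LEVEL b = 0" "\<And>b. s TAKEN b = 0" and K: "n < K"
  shows "main_inv (K * K) (sem main_prog s)"
  unfolding main_prog_def
proof (rule For_For_invariant)
  \<comment> \<open>Nothing is taken at the start, so \<open>full s\<close> can hold only when there
    are no objects, and then \<open>solves\<close> is vacuous.\<close>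
  have "solves (s LEVEL) id" if "m = 0" using that unfolding solves_def by simp
  moreover have "m = 0" if "full s" using that s(3) by (cases m) auto
  ultimately have "full s \<longrightarrow> (\<exists>f. solves (s LEVEL) f)" by blast
  then show "main_inv 0 s"
    unfolding main_inv_def using s(1,2) by simp
  show "u LEN 0 = K" if "main_inv k u" for k u using that by (simp add: main_inv_def inst_def)
  show "main_inv k (upd ROUND1 0 v u)" "main_inv k (upd ROUND2 0 v u)" if "main_inv k u" for k u v
    using that by (simp_all add: main_inv_def inst_upd)
qed (rule main_inv_step[OF _ K])

lemma sem_answer_prog:
  assumes s: "inst s"
  shows "sem answer_prog s 0 0 = of_bool (n = m \<and> full s)"
proof -
  let ?body = "Cond (Cell TAKEN (V BB)) Nop (Assign OK (Const 0) (Const 0))"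
  define I where "I k u \<longleftrightarrow> u TAKEN = s TAKEN \<and>
    u OK 0 = of_bool (n = m \<and> (\<forall>b<k. s TAKEN b \<noteq> 0))" for k and u :: store
  let ?u = "upd OK 0 (of_bool (n = m)) s"
  have eq: "sem (Assign OK (Const 0) (Const 1) ;;
     Cond (Add (Sub (V AGENTS) (V OBJECTS)) (Sub (V OBJECTS) (V AGENTS)))
       (Assign OK (Const 0) (Const 0)) Nop) s = ?u"
    using s by (auto simp: inst_def upd_def)
  have "I (?u OBJECTS 0) (sem (For BB OBJECTS ?body) ?u)"
  proof (rule For_invariant)
    show "I 0 (upd BB 0 0 ?u)" by (simp add: I_def upd_def)
  next
    fix k u assume "I k u" "u BB 0 = k"
    then show "I (Suc k) (upd BB 0 (Suc k) (sem ?body u))"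
      by (auto simp: I_def upd_apply less_Suc_eq)
  qed
  moreover have "?u OBJECTS 0 = m" using s by (simp add: inst_def upd_apply)
  ultimately have "sem (For BB OBJECTS ?body) ?u OK 0 = of_bool (n = m \<and> full s)"
    by (simp add: I_def)
  then show ?thesis
    using eq unfolding answer_prog_def by (simp add: upd_apply)
qed

end

section \<open>Reading the input\<close>

declare encode.simps [simp del]

text \<open>\<open>FLAG\<close> is 0 in the unary block of the agents, 1 in that of the objects and
  2 afterwards.\<close>

definition count_prog :: prog where
  "count_prog = For POS LEN
     (Cond (V FLAG)
        (Cond (Sub (V FLAG) (Const 1)) Nop
           (Cond (Cell 0 (V POS)) (Assign OBJECTS (Const 0) (Add (V OBJECTS) (Const 1)))
              (Assign FLAG (Const 0) (Const 2))))
        (Cond (Cell 0 (V POS)) (Assign AGENTS (Const 0) (Add (V AGENTS) (Const 1)))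
           (Assign FLAG (Const 0) (Const 1))))"

definition multiples_prog :: prog where
  "multiples_prog = For POS LEN
     (Assign MULT (Add (V POS) (Const 1)) (Add (Cell MULT (V POS)) (V OBJECTS)))"

text \<open>The 2 accounts for the separators after the unary blocks;
  \<open>Cell MULT (V AGENTS)\<close> is \<open>n * m\<close>, the length of an edge matrix.\<close>

definition setup_prog :: prog where
  "setup_prog = count_prog ;; multiples_prog ;;
     Assign EDGES (Const 0) (Add (Add (V AGENTS) (V OBJECTS)) (Const 2)) ;;
     Assign FORCED (Const 0) (Add (V EDGES) (Cell MULT (V AGENTS))) ;;
     Assign FORBIDDEN (Const 0) (Add (V FORCED) (Cell MULT (V AGENTS))) ;;
     Assign PREFS (Const 0) (Add (V FORBIDDEN) (Cell MULT (V AGENTS)))"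

lemma sem_count_prog:
  assumes w: "w = replicate n True @ False # replicate m True @ False # rest"
  shows "sem count_prog (input_store w) AGENTS 0 = n" "sem count_prog (input_store w) OBJECTS 0 = m"
proof -
  have bit: "w ! k \<longleftrightarrow> k < n" if "k \<le> n" for k
    using that by (auto simp: w nth_append)
  have bit': "w ! k \<longleftrightarrow> k < Suc (n + m)" if "n < k" "k \<le> Suc (n + m)" for k
    using that by (auto simp: w nth_append nth_Cons split: nat.splits)
  \<comment> \<open>After \<open>k\<close> bits have been read, \<open>FLAG\<close> has advanced
    past the separators at positions \<open>n\<close> and \<open>Suc (n + m)\<close> if these lie
    below \<open>k\<close>.\<close>
  define I where "I k u \<longleftrightarrow> u 0 = input_store w 0 \<and> u FLAG 0 =
      (if k \<le> n then 0 else if k \<le> Suc (n + m) then Suc 0 else 2) \<and>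
    u AGENTS 0 = min k n \<and> u OBJECTS 0 = min (k - Suc n) m" for k and u :: store
  have "I (input_store w LEN 0) (sem count_prog (input_store w))"
    unfolding count_prog_def
  proof (rule For_invariant)
    show "I 0 (upd POS 0 0 (input_store w))"
      by (simp add: I_def) (simp add: input_store_def)
  next
    fix k u assume k: "k < input_store w LEN 0" and I: "I k u" and pos: "u POS 0 = k"
    have "k < length w" using k by (simp add: input_store_def)
    then have "u 0 k = of_bool (w ! k)" using I by (simp add: I_def input_store_def)
    then show "I (Suc k) (upd POS 0 (Suc k) (sem
     (Cond (V FLAG)
        (Cond (Sub (V FLAG) (Const 1)) Nop
           (Cond (Cell 0 (V POS)) (Assign OBJECTS (Const 0) (Add (V OBJECTS) (Const 1)))
              (Assign FLAG (Const 0) (Const 2))))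
        (Cond (Cell 0 (V POS)) (Assign AGENTS (Const 0) (Add (V AGENTS) (Const 1)))
           (Assign FLAG (Const 0) (Const 1)))) u))"
      using I pos bit[of k] bit'[of k] unfolding I_def
      by (cases "k \<le> n"; cases "k \<le> Suc (n + m)") (auto simp: upd_apply min_def)
  qed
  moreover have "input_store w LEN 0 = n + m + 2 + length rest" by (simp add: input_store_def w)
  ultimately show "sem count_prog (input_store w) AGENTS 0 = n"
    "sem count_prog (input_store w) OBJECTS 0 = m"
    by (simp_all add: I_def)
qed

lemma sem_multiples_prog:
  assumes "s MULT 0 = 0" "j \<le> s LEN 0"
  shows "sem multiples_prog s MULT j = j * s OBJECTS 0"
proof -
  define I where "I k u \<longleftrightarrow> u OBJECTS = s OBJECTS \<and> (\<forall>j\<le>k. u MULT j = j * s OBJECTS 0)"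
    for k and u :: store
  have "I (s LEN 0) (sem multiples_prog s)"
    unfolding multiples_prog_def
    by (rule For_invariant) (use assms in \<open>auto simp: I_def upd_apply le_Suc_eq\<close>)
  then show ?thesis using assms(2) by (simp add: I_def)
qed

lemma sem_setup_prog:
  assumes w: "w = replicate n True @ False # replicate m True @ False # rest"
  defines "u \<equiv> sem setup_prog (input_store w)"
  shows "x \<notin> {2..10} \<Longrightarrow> u x = input_store w x"
    and "u AGENTS 0 = n" "u OBJECTS 0 = m" "j \<le> length w \<Longrightarrow> u MULT j = j * m"
    and "u EDGES 0 = n + m + 2" "u FORCED 0 = n + m + 2 + n * m"
    and "u FORBIDDEN 0 = n + m + 2 + 2 * (n * m)" "u PREFS 0 = n + m + 2 + 3 * (n * m)"
proof -
  let ?s = "input_store w"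
  let ?c = "sem count_prog ?s"
  let ?m = "sem multiples_prog ?c"
  have c: "?c x = ?s x" if "x \<noteq> POS" "x \<noteq> FLAG" "x \<noteq> AGENTS" "x \<noteq> OBJECTS" for x
    using that by (simp add: sem_frame count_prog_def)
  have m: "?m x = ?c x" if "x \<noteq> POS" "x \<noteq> MULT" for x
    using that by (simp add: sem_frame multiples_prog_def)
  have len: "?s LEN 0 = length w" by (simp add: input_store_def)
  have "?s MULT 0 = 0" by (simp add: input_store_def)
  then have mult: "?m MULT j = j * m" if "j \<le> length w" for j
    using that sem_multiples_prog[of ?c j] by (simp add: c len sem_count_prog[OF w])
  have n: "n \<le> length w" by (simp add: w)
  show "u x = ?s x" if "x \<notin> {2..10}"
    using that unfolding u_def
    by (intro sem_frame) (auto simp: setup_prog_def count_prog_def multiples_prog_def)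
  show "u AGENTS 0 = n" "u OBJECTS 0 = m" "j \<le> length w \<Longrightarrow> u MULT j = j * m"
    "u EDGES 0 = n + m + 2" "u FORCED 0 = n + m + 2 + n * m"
    "u FORBIDDEN 0 = n + m + 2 + 2 * (n * m)" "u PREFS 0 = n + m + 2 + 3 * (n * m)"
    unfolding u_def setup_prog_def
    by (simp_all add: upd_apply m mult n sem_count_prog[OF w])
qed

lemma length_concat_uniform:
  assumes "\<And>a. length (f a) = m"
  shows "length (concat (map f [0..<n])) = n * m"
  by (induction n) (auto simp: assms)

lemma nth_concat_uniform:
  assumes "\<And>a. length (f a) = m" "a < n" "b < m"
  shows "concat (map f [0..<n]) ! (a * m + b) = f a ! b"
  using \<open>a < n\<close>
proof (induction n)
  case (Suc n)
  have len: "length (concat (map f [0..<n])) = n * m" using assms(1) by (rule length_concat_uniform)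
  show ?case
  proof (cases "a = n")
    case True
    then show ?thesis by (simp add: nth_append len)
  next
    case False
    then have "a < n" using Suc.prems by simp
    then show ?thesis
      using Suc.IH index_less[of a n b m] \<open>b < m\<close> by (simp add: nth_append len)
  qed
qed simp

lemma length_edge_bits: "length (edge_bits n m F) = n * m"
  unfolding edge_bits_def by (rule length_concat_uniform) simp

lemma nth_edge_bits: "a < n \<Longrightarrow> b < m \<Longrightarrow> edge_bits n m F ! (a * m + b) \<longleftrightarrow> (a, b) \<in> F"
  unfolding edge_bits_def by (subst nth_concat_uniform) simp_all

lemma length_pref_bits: "length (pref_bits n m R) = n * (m * m)"
  unfolding pref_bits_def by (intro length_concat_uniform) simp

lemma nth_pref_bits:
  assumes "a < n" "b < m" "c < m"
  shows "pref_bits n m R ! ((a * m + b) * m + c) \<longleftrightarrow> (b, c) \<in> R a"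
proof -
  have "(a * m + b) * m + c = a * (m * m) + (b * m + c)" by (simp add: algebra_simps)
  also have "pref_bits n m R ! \<dots> = concat (map (\<lambda>b. map (\<lambda>b'. (b, b') \<in> R a) [0..<m]) [0..<m]) ! (b * m + c)"
    unfolding pref_bits_def using assms index_less[of b m c m]
    by (intro nth_concat_uniform length_concat_uniform) auto
  also have "\<dots> = map (\<lambda>b'. (b, b') \<in> R a) [0..<m] ! c"
    using assms by (intro nth_concat_uniform) auto
  finally show ?thesis using assms by simp
qed

section \<open>Encoded instances and the correctness of the answer\<close>

locale numbered_instance =
  fixes G :: "(nat, nat) pref_graph" and Fp Fm :: "(nat \<times> nat) set" and n m :: nat
  assumes wf: "wf_pref_graph G" and forced: "Fp \<subseteq> edges G"
    and agents: "agents G = {..<n}" and objects: "objects G = {..<m}"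
begin

abbreviation input :: "bool list" where "input \<equiv> encode (G, Fp, Fm)"

sublocale instance_data n m "length input" "\<lambda>a b. (a, b) \<in> edges G" "\<lambda>a b. (a, b) \<in> Fp"
  "\<lambda>a b. (a, b) \<in> Fm" "\<lambda>a b c. (b, c) \<in> pref G a" .

lemma edge_less: "(a, b) \<in> edges G \<Longrightarrow> a < n \<and> b < m"
  using wf agents objects unfolding wf_pref_graph_def by blast

definition body :: "bool list" where
  "body = edge_bits n m (edges G) @ edge_bits n m Fp @ edge_bits n m Fm @ pref_bits n m (pref G)"

lemma input_eq: "input = replicate n True @ False # replicate m True @ False # body"
  by (simp add: encode.simps body_def Let_def agents objects)

lemma length_input: "length input = n + m + 2 + length body"
  by (simp add: input_eq)

lemma length_body: "length body = 3 * (n * m) + n * (m * m)"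
  by (simp add: body_def length_edge_bits length_pref_bits)

lemma input_nth: "i < length body \<Longrightarrow> input_store input 0 (n + m + 2 + i) = of_bool (body ! i)"
proof -
  have "input ! (n + m + 2 + i) = body ! i"
    using nth_append_length_plus[of "replicate n True @ False # replicate m True @ [False]" body i]
    by (simp add: input_eq)
  moreover assume "i < length body"
  ultimately show ?thesis by (simp add: input_store_def length_input)
qed

lemma body_nth:
  assumes "a < n" "b < m"
  shows "body ! (a * m + b) \<longleftrightarrow> (a, b) \<in> edges G"
    and "body ! (n * m + (a * m + b)) \<longleftrightarrow> (a, b) \<in> Fp"
    and "body ! (2 * (n * m) + (a * m + b)) \<longleftrightarrow> (a, b) \<in> Fm"
    and "c < m \<Longrightarrow> body ! (3 * (n * m) + ((a * m + b) * m + c)) \<longleftrightarrow> (b, c) \<in> pref G a"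
  using assms index_less[of a n b m]
  by (simp_all add: body_def nth_append length_edge_bits nth_edge_bits nth_pref_bits)

lemma inst_setup: "inst (sem setup_prog (input_store input))"
proof -
  let ?u = "sem setup_prog (input_store input)"
  note u = sem_setup_prog[OF input_eq]
  \<comment> \<open>The edge matrix alone has \<open>n * m\<close> bits, so \<open>MULT\<close> is
    filled far enough for the nested lookup.\<close>
  have nm: "n * m \<le> length input" by (simp add: length_input length_body)
  have u0: "?u 0 = input_store input 0" by (rule u(1)) simp
  have len: "?u LEN 0 = length input" by (subst u(1)) (simp_all add: input_store_def)
  have mult: "?u MULT a = a * m" if "a < n" for a
    using that by (intro u(4)) (simp add: length_input)
  have mult': "?u MULT (a * m + b) = (a * m + b) * m" if "a < n" "b < m" for a b
    using index_less[OF that] nm by (intro u(4)) simp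
  have lb: "(a * m + b) * m + c < n * (m * m)" if "a < n" "b < m" "c < m" for a b c
    using index_less[OF index_less[OF that(1,2)] that(3)] by (simp add: mult.assoc)
  have below: "k * (n * m) + i < length body" if "k < 3" "i < n * m" for k i
    unfolding length_body by (rule trans_less_add1[OF index_less[OF that]])
  show ?thesis
    unfolding inst_def
  proof (intro conjI allI impI)
    fix a b assume ab: "a < n" "b < m"
    note i = index_less[OF ab]
    show "?u 0 (?u EDGES 0 + (a * m + b)) = of_bool ((a, b) \<in> edges G)"
      unfolding u0 u(5) using below[OF _ i, of 0] body_nth(1)[OF ab] by (subst input_nth) simp_all
    show "?u 0 (?u FORCED 0 + (a * m + b)) = of_bool ((a, b) \<in> Fp)"
      unfolding u0 u(6) add.assoc[of _ "n * m"]
      using below[OF _ i, of 1] body_nth(2)[OF ab] by (subst input_nth) simp_all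
    show "?u 0 (?u FORBIDDEN 0 + (a * m + b)) = of_bool ((a, b) \<in> Fm)"
      unfolding u0 u(7) add.assoc[of _ "2 * (n * m)"]
      using below[OF _ i, of 2] body_nth(3)[OF ab] by (subst input_nth) simp_all
    fix c assume c: "c < m"
    show "?u 0 (?u PREFS 0 + (?u MULT (a * m + b) + c)) = of_bool ((b, c) \<in> pref G a)"
      unfolding u0 u(8) mult'[OF ab] add.assoc[of _ "3 * (n * m)"]
      using lb[OF ab c] body_nth(4)[OF ab c] by (subst input_nth) (simp_all add: length_body)
  qed (use u len mult in auto)
qed

text \<open>For equal numbers the injection \<open>f\<close> is bijective, and its inverse is the
  matching. Absence of bad neighbors gives the certificate and, as a missed forced edge would be
  bad, also the forced edges.\<close>

lemma solves_popular:
  assumes nm: "n = m" and sol: "solves l f"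
  shows "\<exists>M. popular_assignment G M \<and> Fp \<subseteq> M \<and> Fm \<inter> M = {}"
proof -
  have f: "inj_on f {..<m}" "\<And>b. b < m \<Longrightarrow> f b < n" "\<And>b. b < m \<Longrightarrow> adm l (f b) b"
    using sol by (auto simp: solves_def)
  have "f ` {..<m} = {..<n}"
    using f nm by (intro card_subset_eq) (auto simp: card_image)
  then have bij: "bij_betw f {..<m} {..<n}" using f(1) by (simp add: bij_betw_def)
  define g where "g = inv_into {..<m} f"
  have g: "bij_betw g {..<n} {..<m}" using bij unfolding g_def by (rule bij_betw_inv_into)
  have fg: "f (g a) = a" if "a < n" for a
    using bij that unfolding g_def bij_betw_def by (simp add: f_inv_into_f)
  have gm: "g a < m" if "a < n" for a using g that by (auto simp: bij_betw_def)
  have adm: "adm l a (g a)" if "a < n" for a using f(3)[OF gm[OF that]] fg[OF that] by simp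
  let ?M = "(\<lambda>a. (a, g a)) ` agents G"
  have "perfect_matching G ?M"
    using g adm agents objects by (intro perfect_matching_image) (auto simp: adm_def)
  moreover have "certificate G ?M (\<lambda>b. int (l b))"
    unfolding certificate_def
  proof (clarify)
    fix a c assume a: "a \<in> agents G" and c: "c \<in> neighbors G a"
    have "(a, c) \<in> edges G" using c by (simp add: neighbors_def)
    moreover from this have "\<not> bad l a (g a) c" using adm[of a] edge_less by (auto simp: adm_def)
    ultimately show "int (l c) + outvotes G a c (g a) \<le> int (l (g a))"
      by (auto simp: bad_def outvotes_def not_less of_bool_def split: if_splits)
  qed
  ultimately have "popular_assignment G ?M" by (rule certificate_popular[OF wf])
  moreover have "(a, c) \<in> ?M" if ac: "(a, c) \<in> Fp" for a c
  proof -
    have "a < n" "c < m" "(a, c) \<in> edges G" using ac forced edge_less by blast+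
    then have "\<not> bad l a (g a) c" using adm by (auto simp: adm_def)
    then have "g a = c" using ac \<open>(a, c) \<in> edges G\<close> by (auto simp: bad_def)
    then show ?thesis using \<open>a < n\<close> agents by auto
  qed
  then have "Fp \<subseteq> ?M" by auto
  moreover have "Fm \<inter> ?M = {}" using adm agents by (auto simp: adm_def)
  ultimately show ?thesis by blast
qed

text \<open>The levels of \<open>popular_certificate\<close> are nonnegative, so converting them to
  natural numbers loses nothing; their bound \<open>m\<close> limits the number of rounds.\<close>

lemma popular_solves:
  assumes pop: "popular_assignment G M" and M: "Fp \<subseteq> M" "Fm \<inter> M = {}"
  obtains l f where "n = m" "solves l f" "\<And>b. b < m \<Longrightarrow> l b \<le> m"
proof -
  obtain l where cert: "certificate G M l"
    "\<forall>b \<in> objects G. 0 \<le> l b \<and> l b \<le> int (card (objects G))"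
    by (rule popular_certificate[OF wf pop])
  have l: "certificate G M l" "\<And>b. b < m \<Longrightarrow> 0 \<le> l b \<and> l b \<le> int m"
    using cert objects by simp_all
  have PM: "perfect_matching G M" using pop by (simp add: popular_assignment_def)
  obtain g where g: "M = (\<lambda>a. (a, g a)) ` agents G" "bij_betw g (agents G) (objects G)"
    using perfect_matching_fun[OF PM] .
  have nm: "n = m" using bij_betw_same_card[OF g(2)] agents objects by simp
  define f where "f = inv_into (agents G) g"
  have "bij_betw f (objects G) (agents G)" using g(2) unfolding f_def by (rule bij_betw_inv_into)
  then have f: "inj_on f {..<m}" "\<And>b. b < m \<Longrightarrow> f b < n"
    unfolding bij_betw_def agents objects by (auto simp only: lessThan_iff image_iff)
  have gf: "g (f b) = b" if "b < m" for b
    using g(2) that objects unfolding f_def bij_betw_def by (simp add: f_inv_into_f)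
  have fM: "(f b, b) \<in> M" if "b < m" for b
    using f(2)[OF that] gf[OF that] agents g(1) by force
  have uniq: "(a, b) \<in> M \<Longrightarrow> (a, c) \<in> M \<Longrightarrow> b = c" for a b c
    using PM unfolding perfect_matching_def matching_def by blast
  let ?l = "\<lambda>b. nat (l b)"
  have "adm ?l (f b) b" if b: "b < m" for b
  proof -
    have "\<not> bad ?l (f b) b c" if c: "c < m" for c
    proof
      assume bad: "bad ?l (f b) b c"
      then have "c \<in> neighbors G (f b)" by (simp add: bad_def neighbors_def)
      then have "l c + outvotes G (f b) c b \<le> l b"
        using l(1) fM[OF b] unfolding certificate_def by blast
      moreover have "\<not> ((f b, c) \<in> Fp \<and> b \<noteq> c)" using uniq[OF fM[OF b]] M(1) by blast
      ultimately show False
        using bad l(2)[OF b] l(2)[OF c] by (auto simp: bad_def outvotes_def of_bool_def split: if_splits)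
    qed
    moreover have "(f b, b) \<in> edges G" "(f b, b) \<notin> Fm"
      using fM[OF b] M(2) PM by (auto simp: perfect_matching_def matching_def)
    ultimately show ?thesis by (simp add: adm_def)
  qed
  then have "solves ?l f" using f by (simp add: solves_def)
  moreover have "?l b \<le> m" if "b < m" for b using l(2)[OF that] by (simp add: nat_le_iff)
  ultimately show ?thesis using that nm by blast
qed

text \<open>If a solution exists, the levels stay at most \<open>m\<close>. Their sum is then below
  the number of rounds, so the invariant forces \<open>full s\<close>.\<close>

lemma main_inv_answer:
  assumes inv: "main_inv (length input * length input) s"
  shows "n = m \<and> full s \<longleftrightarrow> (\<exists>M. popular_assignment G M \<and> Fp \<subseteq> M \<and> Fm \<inter> M = {})"
proof
  assume "n = m \<and> full s"
  then show "\<exists>M. popular_assignment G M \<and> Fp \<subseteq> M \<and> Fm \<inter> M = {}"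
    using inv solves_popular unfolding main_inv_def by blast
next
  assume "\<exists>M. popular_assignment G M \<and> Fp \<subseteq> M \<and> Fm \<inter> M = {}"
  then obtain l f where l: "n = m" "solves l f" "\<And>b. b < m \<Longrightarrow> l b \<le> m"
    using popular_solves by metis
  have "s LEVEL b \<le> m" if "b < m" for b
    using inv l(2) l(3)[OF that] that unfolding main_inv_def by (meson le_trans)
  then have "(\<Sum>b<m. s LEVEL b) \<le> (\<Sum>b<m. m)" by (intro sum_mono) auto
  also have "\<dots> < length input * length input"
  proof -
    have "m < length input" by (simp add: length_input)
    from mult_strict_mono'[OF this this] show ?thesis by simp
  qed
  finally show "n = m \<and> full s" using inv l(1) unfolding main_inv_def by auto
qed

text \<open>\<open>exec_code\<close> does not allow loop bounds to be written, but the setup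
  computes the bounds of later loops. Hence setup and remainder are timed separately and joined by
  \<open>exec.Seq\<close>.\<close>

lemma decides:
  obtains t s where
    "exec (Seq (code setup_prog) (code (main_prog ;; answer_prog))) (input_store input) t s"
    "t \<le> poly (time_poly setup_prog + time_poly (main_prog ;; answer_prog)) (length input)"
    "s 0 0 = of_bool (\<exists>M. popular_assignment G M \<and> Fp \<subseteq> M \<and> Fm \<inter> M = {})"
proof -
  let ?i = "input_store input" and ?K = "length input"
  let ?u = "sem setup_prog ?i" and ?p = "main_prog ;; answer_prog"
  note u = sem_setup_prog[OF input_eq]
  have len: "?i LEN 0 = ?K" by (simp add: input_store_def)
  have inst_u: "inst ?u" by (rule inst_setup)
  obtain t1 where t1: "t1 \<le> poly (time_poly setup_prog) ?K" "exec (code setup_prog) ?i t1 ?u"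
    using exec_code[of setup_prog ?i ?K] len
    by (auto simp: setup_prog_def count_prog_def multiples_prog_def simp del: time_poly.simps)
  have "\<exists>t \<le> poly (time_poly ?p) ?K. exec (code ?p) ?u t (sem ?p ?u)"
  proof (rule exec_code)
    show "proper ?p" by (simp add: main_prog_def answer_prog_def prog_defs)
    show "bounds ?p \<inter> writes ?p = {}" by (simp add: main_prog_def answer_prog_def prog_defs)
    have "bounds ?p \<subseteq> {LEN, AGENTS, OBJECTS}"
      by (simp add: main_prog_def answer_prog_def prog_defs)
    then show "?u x 0 \<le> ?K" if "x \<in> bounds ?p" for x
      using that inst_size[OF inst_u] by (auto simp: length_input)
  qed
  then obtain t2 where t2: "t2 \<le> poly (time_poly ?p) ?K" "exec (code ?p) ?u t2 (sem ?p ?u)"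
    by blast
  \<comment> \<open>The setup leaves the arrays above 10 untouched, so levels and
    \<open>TAKEN\<close> start at 0.\<close>
  have zero: "?u x b = 0" if "10 < x" for x b
    using that by (subst u(1)) (auto simp: input_store_def)
  have "main_inv (?K * ?K) (sem main_prog ?u)"
    using inst_u zero by (intro sem_main_prog) (simp_all add: length_input)
  then have out: "sem ?p ?u 0 0 = of_bool (\<exists>M. popular_assignment G M \<and> Fp \<subseteq> M \<and> Fm \<inter> M = {})"
    using main_inv_answer sem_answer_prog by (simp add: main_inv_def)
  have time: "t1 + t2 \<le> poly (time_poly setup_prog + time_poly ?p) ?K"
    using t1(1) t2(1) by simp
  show ?thesis by (rule that[OF exec.Seq[OF t1(2) t2(2)] time out])
qed

end

theorem theorem5:
  "poly_time_decidable encode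
     {(G, Fp, Fm). wf_pref_graph G \<and> numbered G \<and> Fp \<subseteq> edges G \<and> Fm \<subseteq> edges G}
     (\<lambda>(G, Fp, Fm). \<exists>M. popular_assignment G M \<and> Fp \<subseteq> M \<and> Fm \<inter> M = {})"
  unfolding poly_time_decidable_def
proof (rule exI, rule exI, rule ballI)
  fix x :: "(nat, nat) pref_graph \<times> (nat \<times> nat) set \<times> (nat \<times> nat) set"
  assume x: "x \<in> {(G, Fp, Fm). wf_pref_graph G \<and> numbered G \<and> Fp \<subseteq> edges G \<and> Fm \<subseteq> edges G}"
  obtain G Fp Fm where G: "x = (G, Fp, Fm)" by (cases x)
  interpret numbered_instance G Fp Fm "card (agents G)" "card (objects G)"
    using x unfolding G numbered_def by unfold_locales blast+
  \<comment> \<open>The witnesses for program and polynomial are fixed here; both are independent of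
    the instance.\<close>
  show "\<exists>t s. exec (Seq (code setup_prog) (code (main_prog ;; answer_prog))) (input_store (encode x)) t s \<and>
    t \<le> poly (time_poly setup_prog + time_poly (main_prog ;; answer_prog)) (length (encode x)) \<and>
    s 0 0 = (if case x of (G, Fp, Fm) \<Rightarrow> \<exists>M. popular_assignment G M \<and> Fp \<subseteq> M \<and> Fm \<inter> M = {} then 1 else 0)"
    using decides unfolding G by (metis (mono_tags, lifting) of_bool_def case_prod_conv)
qed

end
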